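(* Let $\mathbf{u_p} = \mathbf{u}(1^{\omega}, (EERR)^{\omega})$ be the binary generalized pseudostandard word with directive bi-sequence $(1^{\omega}, (EERR)^{\omega})$, and let $\mathcal{C}_{\mathbf{u_p}}(n)$ be the number of distinct factors of length $n$ of $\mathbf{u_p}$. Then $$\limsup_{n\to\infty}\frac{\mathcal{C}_{\mathbf{u_p}}(n)}{n} \geq 4.57735.$$
   Context: Words are over the alphabet $\{0,1\}$; $\varepsilon$ is the empty word. An antimorphism is a map $\vartheta:\{0,1\}^*\to\{0,1\}^*$ with $\vartheta(vw)=\vartheta(w)\vartheta(v)$. $R$ is the reversal antimorphism ($R(0)=0$, $R(1)=1$) and $E$ is the exchange antimorphism ($E(0)=1$, $E(1)=0$; i.e. $E(w)$ is the reversal of $w$ with letters $0$ and $1$ swapped). For $\vartheta\in\{E,R\}$, a finite word $w$ is a $\vartheta$-palindrome if $\vartheta(w)=w$, and the closure $w^{\vartheta}$ is the shortest $\vartheta$-palindrome having $w$ as a prefix. Given $\Delta=\delta_1\delta_2\ldots$ with $\delta_i\in\{0,1\}$ and $\Theta=\vartheta_1\vartheta_2\ldots$ with $\vartheta_i\in\{E,R\}$, the generalized pseudostandard word $\mathbf{u}(\Delta,\Theta)$ is the infinite word whose prefixes $w_n$ are given by $w_0=\varepsilon$ and $w_{n+1}=(w_n\delta_{n+1})^{\vartheta_{n+1}}$. For $\mathbf{u_p}$, $\delta_i=1$ for all $i$ and $\Theta$ is the periodic repetition of $E,E,R,R$; e.g. $w_1=10$, $w_2=1010$, $w_3=10101$,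 $w_4=1010110101$. A factor of an infinite word is a finite block of consecutive letters of it. *)

theory Defs
  imports "HOL-Library.Extended_Real" "HOL-Library.Sublist"
begin

text \<open>Letters are Booleans: 0 is \<^term>\<open>False\<close> and 1 is \<^term>\<open>True\<close>.\<close>

type_synonym word = "bool list"

definition antimorphism :: "(word \<Rightarrow> word) \<Rightarrow> bool" where
  "antimorphism \<theta> \<longleftrightarrow> (\<forall>v w. \<theta> (v @ w) = \<theta> w @ \<theta> v)"

definition anti_R :: "word \<Rightarrow> word" where
  "anti_R w = rev w"

definition anti_E :: "word \<Rightarrow> word" where
  "anti_E w = rev (map Not w)"

definition pal :: "(word \<Rightarrow> word) \<Rightarrow> word \<Rightarrow> bool" where
  "pal \<theta> w \<longleftrightarrow> \<theta> w = w"

definition closure :: "(word \<Rightarrow> word) \<Rightarrow> word \<Rightarrow> word" where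
  "closure \<theta> w = (ARG_MIN length p. pal \<theta> p \<and> prefix w p)"

text \<open>Directive sequences are indexed from 0, so that \<open>\<Delta> n\<close> and \<open>\<Theta> n\<close> stand for
  \<open>\<delta>\<close> and \<open>\<theta>\<close> with index \<open>n + 1\<close>.\<close>

primrec gps_prefix :: "(nat \<Rightarrow> bool) \<Rightarrow> (nat \<Rightarrow> word \<Rightarrow> word) \<Rightarrow> nat \<Rightarrow> word" where
  "gps_prefix \<Delta> \<Theta> 0 = []"
| "gps_prefix \<Delta> \<Theta> (Suc n) = closure (\<Theta> n) (gps_prefix \<Delta> \<Theta> n @ [\<Delta> n])"

text \<open>Letter \<open>i\<close> of the infinite word is read off prefix number \<open>i + 1\<close>, which is long enough;
  lemma \<open>gps_word_prefix\<close> below shows that this is the word with the given prefixes.\<close>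

definition gps_word :: "(nat \<Rightarrow> bool) \<Rightarrow> (nat \<Rightarrow> word \<Rightarrow> word) \<Rightarrow> nat \<Rightarrow> bool" where
  "gps_word \<Delta> \<Theta> i = gps_prefix \<Delta> \<Theta> (Suc i) ! i"

definition factors :: "(nat \<Rightarrow> 'a) \<Rightarrow> nat \<Rightarrow> 'a list set" where
  "factors u n = {map u [i..<i + n] | i. True}"

definition factor_complexity :: "(nat \<Rightarrow> 'a) \<Rightarrow> nat \<Rightarrow> nat" where
  "factor_complexity u n = card (factors u n)"

definition EERR :: "nat \<Rightarrow> word \<Rightarrow> word" where
  "EERR n = [anti_E, anti_E, anti_R, anti_R] ! (n mod 4)"

definition u_p :: "nat \<Rightarrow> bool" where
  "u_p = gps_word (\<lambda>_. True) EERR"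


lemma anti_E_R:
  assumes "\<theta> \<in> {anti_E, anti_R}"
  shows "antimorphism \<theta>" and "length (\<theta> w) = length w" and "\<theta> (\<theta> w) = w"
  using assms by (auto simp: antimorphism_def anti_E_def anti_R_def rev_map comp_def)

lemma closure_props:
  assumes "\<theta> \<in> {anti_E, anti_R}"
  shows "pal \<theta> (closure \<theta> w)" and "prefix w (closure \<theta> w)"
    and "pal \<theta> q \<Longrightarrow> prefix w q \<Longrightarrow> length (closure \<theta> w) \<le> length q"
proof -
  have "pal \<theta> (w @ \<theta> w) \<and> prefix w (w @ \<theta> w)"
    using anti_E_R[OF assms] by (auto simp: pal_def antimorphism_def)
  note * = arg_min_nat_lemma[where P = "\<lambda>p. pal \<theta> p \<and> prefix w p" and m = length, OF this]
  show "pal \<theta> (closure \<theta> w)" "prefix w (closure \<theta> w)"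
    "pal \<theta> q \<Longrightarrow> prefix w q \<Longrightarrow> length (closure \<theta> w) \<le> length q"
    using * unfolding closure_def by auto
qed

lemma pal_unique:
  assumes "\<theta> \<in> {anti_E, anti_R}" "pal \<theta> p" "pal \<theta> q" "prefix w p" "prefix w q"
    and "length p = length q" "length p \<le> 2 * length w"
  shows "p = q"
proof -
  obtain p' q' where pq: "p = w @ p'" "q = w @ q'"
    using assms(4,5) by (auto simp: prefix_def)
  have len: "length p' = length q'" "length p' \<le> length w"
    using assms(6,7) pq by auto
  note a = anti_E_R[OF assms(1)]
  have eq: "r' = \<theta> (take (length r') w)"
    if "pal \<theta> (w @ r')" "length r' \<le> length w" for r'
  proof -
    have "w @ r' = \<theta> (take (length r') w @ drop (length r') w @ r')"
      using that(1) by (simp add: pal_def flip: append_assoc)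
    also have "\<dots> = \<theta> (drop (length r') w @ r') @ \<theta> (take (length r') w)"
      using a(1) by (simp only: antimorphism_def)
    finally have "w @ r' = \<theta> (drop (length r') w @ r') @ \<theta> (take (length r') w)" .
    moreover have "length (\<theta> (take (length r') w)) = length r'"
      using that(2) by (simp add: a(2))
    ultimately show ?thesis by simp
  qed
  show ?thesis using eq[of p'] eq[of q'] len assms(2,3) pq by simp
qed

lemma closure_eqI:
  assumes "\<theta> \<in> {anti_E, anti_R}" "pal \<theta> p" "prefix w p"
    and "\<And>q. pal \<theta> q \<Longrightarrow> prefix w q \<Longrightarrow> length p \<le> length q"
  shows "closure \<theta> w = p"
proof (rule pal_unique[OF assms(1) _ assms(2) _ assms(3)])
  note c = closure_props(1,2)[OF assms(1), of w]
  show "pal \<theta> (closure \<theta> w)" "prefix w (closure \<theta> w)" by (fact c)+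
  show "length (closure \<theta> w) = length p"
    using closure_props(3)[OF assms(1,2,3)] assms(4)[OF c] by (rule le_antisym)
  have "pal \<theta> (w @ \<theta> w)" "prefix w (w @ \<theta> w)"
    using anti_E_R[OF assms(1)] by (auto simp: pal_def antimorphism_def)
  from closure_props(3)[OF assms(1) this] show "length (closure \<theta> w) \<le> 2 * length w"
    using anti_E_R(2)[OF assms(1)] by simp
qed

lemma gps_prefix_mono:
  assumes "\<And>n. \<Theta> n \<in> {anti_E, anti_R}" "m \<le> n"
  shows "prefix (gps_prefix \<Delta> \<Theta> m) (gps_prefix \<Delta> \<Theta> n)"
  using assms(2)
proof (induction n rule: dec_induct)
  case (step n)
  have "prefix (gps_prefix \<Delta> \<Theta> n) (gps_prefix \<Delta> \<Theta> (Suc n))"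
    unfolding gps_prefix.simps by (rule append_prefixD[OF closure_props(2)[OF assms(1)]])
  then show ?case using step.IH by (rule prefix_order.trans[rotated])
qed simp

lemma gps_prefix_length:
  assumes "\<And>n. \<Theta> n \<in> {anti_E, anti_R}"
  shows "n \<le> length (gps_prefix \<Delta> \<Theta> n)"
proof (induction n)
  case (Suc n)
  have "length (gps_prefix \<Delta> \<Theta> n @ [\<Delta> n]) \<le> length (gps_prefix \<Delta> \<Theta> (Suc n))"
    unfolding gps_prefix.simps by (intro prefix_length_le closure_props(2) assms)
  then show ?case using Suc by simp
qed simp

lemma gps_word_prefix:
  assumes "\<And>n. \<Theta> n \<in> {anti_E, anti_R}"
  shows "map (gps_word \<Delta> \<Theta>) [0..<length (gps_prefix \<Delta> \<Theta> n)] = gps_prefix \<Delta> \<Theta> n"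
proof (rule nth_equalityI)
  fix i assume "i < length (map (gps_word \<Delta> \<Theta>) [0..<length (gps_prefix \<Delta> \<Theta> n)])"
  then have i: "i < length (gps_prefix \<Delta> \<Theta> n)" by simp
  have i': "i < length (gps_prefix \<Delta> \<Theta> (Suc i))"
    using gps_prefix_length[of \<Theta> "Suc i" \<Delta>, OF assms] by simp
  have "prefix (gps_prefix \<Delta> \<Theta> n) (gps_prefix \<Delta> \<Theta> (Suc i)) \<or>
        prefix (gps_prefix \<Delta> \<Theta> (Suc i)) (gps_prefix \<Delta> \<Theta> n)"
    using gps_prefix_mono[of \<Theta> n "Suc i", OF assms] gps_prefix_mono[of \<Theta> "Suc i" n, OF assms]
      nat_le_linear[of n "Suc i"] by auto
  then have "gps_prefix \<Delta> \<Theta> (Suc i) ! i = gps_prefix \<Delta> \<Theta> n ! i"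
    using i i' by (auto simp: prefix_def nth_append simp del: gps_prefix.simps)
  then show "map (gps_word \<Delta> \<Theta>) [0..<length (gps_prefix \<Delta> \<Theta> n)] ! i = gps_prefix \<Delta> \<Theta> n ! i"
    using i by (simp add: gps_word_def del: gps_prefix.simps)
qed simp

end

theory Submission
  imports Defs
begin

text \<open>Let \<open>v\<close> be the sequence of sums mod 2 of adjacent letters of \<open>u_p\<close>. Taking such sums turns both
  E-palindromes and R-palindromes into palindromes, so the prefixes of \<open>u_p\<close> that define it
  become palindromic prefixes \<open>p\<^sub>n\<close> of \<open>v\<close>, and \<open>u_p\<close> has at least twice as many factors of length
  \<open>n + 1\<close> as \<open>v\<close> has factors of length \<open>n\<close>. The \<open>p\<^sub>n\<close> satisfy explicit recurrences; that the closures are not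
  shorter follows because, by the theorem of Fine and Wilf, \<open>p\<^sub>n\<close> has no borders apart from the
  \<open>p\<^sub>j\<close> with \<open>j < n\<close> and two short ones.

  Besides the suffixes of the \<open>p\<^sub>n\<close>, the suffixes of the palindrome \<open>b\<^sub>j\<close> obtained by extending
  \<open>p\<^bsub>j+2\<^esub>\<close> symmetrically by \<open>|p\<^sub>j| - |p\<^bsub>j-1\<^esub>|\<close> letters are right special for odd \<open>j\<close>, and they are new
  as soon as they are longer than \<open>p\<^sub>j\<close>. So there are always two right special factors of \<open>v\<close>, and three
  for the lengths in the range from \<open>|p\<^bsub>j+2\<^esub>|\<close> to \<open>|b\<^sub>j|\<close>. Summing up, the complexity ratio
  of \<open>u_p\<close> at \<open>|b\<^sub>j| + 2\<close> tends to at least \<open>4 + 1 / sqrt 3 = 4.577350...\<close>\<close>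

section \<open>Periods of words\<close>

definition period :: "nat \<Rightarrow> 'a list \<Rightarrow> bool" where
  "period g xs \<longleftrightarrow> (\<forall>i. i + g < length xs \<longrightarrow> xs ! i = xs ! (i + g))"

text \<open>One steps back by \<open>p\<close> and forward by \<open>q\<close> or, near the left
  end, forward by \<open>q\<close> first and then back by \<open>p\<close>. The bound on the length
  leaves room for one of the two.\<close>

lemma period_diff:
  assumes "period p xs" "period q xs" "p \<le> q" "p + q \<le> length xs"
  shows "period (q - p) xs"
  unfolding period_def
proof (intro allI impI)
  fix i assume i: "i + (q - p) < length xs"
  show "xs ! i = xs ! (i + (q - p))"
  proof (cases "p \<le> i")
    case True
    have "xs ! (i - p) = xs ! i"
      using assms(1) True i unfolding period_def by (metis le_add_diff_inverse2 add_leD1 le_less_trans le_add1)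
    moreover have "xs ! (i - p) = xs ! (i - p + q)"
      using assms(2,3) True i unfolding period_def by simp
    ultimately show ?thesis using True assms(3) by (simp add: add.commute)
  next
    case False
    have "xs ! i = xs ! (i + q)"
      using assms(2,4) False unfolding period_def by simp
    moreover have "xs ! (i + (q - p)) = xs ! (i + (q - p) + p)"
      using assms(1,3,4) False unfolding period_def by simp
    ultimately show ?thesis using assms(3) by simp
  qed
qed

text \<open>The weak form of the theorem of Fine and Wilf.\<close>

lemma period_gcd:
  assumes "period p xs" "period q xs" "p + q \<le> length xs" "0 < p" "0 < q"
  shows "period (gcd p q) xs"
  using assms
proof (induction "p + q" arbitrary: p q rule: less_induct)
  case less
  show ?case
  proof (cases p q rule: linorder_cases)
    case equal
    then show ?thesis using less.prems by simp
  next
    case less': less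
    have "period (gcd p (q - p)) xs"
      using less.prems less' by (intro less.hyps period_diff) auto
    moreover have "gcd p (q - p) = gcd p q"
      using less' gcd_diff1_nat[of p q] by (simp add: gcd.commute)
    ultimately show ?thesis by simp
  next
    case greater
    have "period (gcd (p - q) q) xs"
      using less.prems greater by (intro less.hyps period_diff) auto
    moreover have "gcd (p - q) q = gcd p q"
      using greater gcd_diff1_nat[of q p] by simp
    ultimately show ?thesis by simp
  qed
qed

lemma period_prefix: "period g ys \<Longrightarrow> prefix xs ys \<Longrightarrow> period g xs"
  unfolding period_def prefix_def
proof (intro allI impI)
  fix i assume *: "\<forall>i. i + g < length ys \<longrightarrow> ys ! i = ys ! (i + g)" "\<exists>zs. ys = xs @ zs"
    and i: "i + g < length xs"
  from *(2) obtain zs where ys: "ys = xs @ zs" ..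
  have "ys ! i = ys ! (i + g)" using *(1) i ys by simp
  then show "xs ! i = xs ! (i + g)" using i by (simp add: ys nth_append)
qed

lemma period_of_border:
  assumes "prefix xs zs" "suffix xs zs"
  shows "period (length zs - length xs) zs"
proof -
  obtain a b where a: "zs = xs @ a" and b: "zs = b @ xs"
    using assms unfolding prefix_def suffix_def by blast
  have l: "length zs - length xs = length b" by (simp add: b)
  show ?thesis unfolding period_def l
  proof (intro allI impI)
    fix i assume i: "i + length b < length zs"
    then have i': "i < length xs" using b by simp
    have "zs ! i = xs ! i" by (simp add: a nth_append i')
    also have "\<dots> = zs ! (i + length b)" by (simp add: b nth_append)
    finally show "zs ! i = zs ! (i + length b)" .
  qed
qed

lemma dvd_less_mult2:
  fixes g m :: nat
  assumes "g dvd m" "g < m"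
  shows "2 * g \<le> m"
proof -
  obtain k where k: "m = g * k" using assms(1) by blast
  then have "k \<noteq> 0" "k \<noteq> 1" using assms(2) by auto
  then have "2 \<le> k" by simp
  then show ?thesis using k by (simp add: mult.commute)
qed

lemma dvd_less_mult3:
  fixes g m :: nat
  assumes "g dvd m" "g < m" "m \<noteq> 2 * g"
  shows "3 * g \<le> m"
proof -
  obtain k where k: "m = g * k" using assms(1) by blast
  then have "k \<noteq> 0" "k \<noteq> 1" "k \<noteq> 2" using assms(2,3) by auto
  then have "3 \<le> k" by simp
  then show ?thesis using k by (simp add: mult.commute)
qed

section \<open>Sums of adjacent letters and palindromes\<close>

text \<open>\<open>accumulate c\<close> inverts the passage to sums of adjacent letters; \<open>c\<close> is the first letter.\<close>

primrec accumulate :: "bool \<Rightarrow> bool list \<Rightarrow> bool list" where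
  "accumulate c [] = [c]"
| "accumulate c (x # xs) = c # accumulate (c \<noteq> x) xs"

text \<open>Tells whether the first and the last letter of \<open>accumulate c xs\<close> differ,
  which separates E-palindromes from R-palindromes.\<close>

primrec parity :: "bool list \<Rightarrow> bool" where
  "parity [] = False"
| "parity (x # xs) = (x \<noteq> parity xs)"

lemma parity_append [simp]: "parity (xs @ ys) = (parity xs \<noteq> parity ys)"
  by (induction xs) auto

lemma parity_rev [simp]: "parity (rev xs) = parity xs"
  by (induction xs) auto

lemma length_accumulate [simp]: "length (accumulate c xs) = Suc (length xs)"
  by (induction xs arbitrary: c) auto

lemma accumulate_not_Nil [simp]: "accumulate c xs \<noteq> []" "[] \<noteq> accumulate c xs"
  by (cases xs; simp)+

lemma hd_accumulate [simp]: "hd (accumulate c xs) = c"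
  by (cases xs) auto

lemma accumulate_append: "accumulate c (xs @ y # ys) = accumulate c xs @ accumulate ((c \<noteq> parity xs) \<noteq> y) ys"
proof (induction xs arbitrary: c)
  case (Cons x xs)
  then show ?case by (cases x; cases c; cases y; cases "parity xs") simp_all
qed simp

lemma accumulate_inject: "accumulate c xs = accumulate c' ys \<longleftrightarrow> c = c' \<and> xs = ys"
proof (induction xs arbitrary: ys c c')
  case Nil then show ?case by (cases ys) auto
next
  case (Cons x xs) then show ?case by (cases ys) auto
qed

text \<open>Sums of adjacent letters do not depend on the reading direction. The reversed word
  starts with the former last letter, which is \<open>c \<noteq> parity xs\<close>.\<close>

lemma rev_accumulate: "rev (accumulate c xs) = accumulate (c \<noteq> parity xs) (rev xs)"
proof (induction xs arbitrary: c)
  case (Cons x xs)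
  then show ?case
    by (cases x; cases c; cases "parity xs") (simp_all add: accumulate_append[where ys = "[]"])
qed simp

lemma map_Not_accumulate: "map Not (accumulate c xs) = accumulate (\<not> c) xs"
  by (induction xs arbitrary: c) auto

lemma accumulate_exhaust: "ws \<noteq> [] \<Longrightarrow> \<exists>xs. ws = accumulate (hd ws) xs"
proof (induction ws)
  case (Cons w ws)
  show ?case
  proof (cases "ws = []")
    case True
    then have "w # ws = accumulate (hd (w # ws)) []" by simp
    then show ?thesis by blast
  next
    case False
    then obtain xs where "ws = accumulate (hd ws) xs" using Cons by blast
    then have "w # ws = accumulate (hd (w # ws)) ((w \<noteq> hd ws) # xs)"
      by (cases w; cases "hd ws") simp_all
    then show ?thesis by blast
  qed
qed simp

lemma prefix_accumulate: "prefix (accumulate c xs) (accumulate c ys) \<longleftrightarrow> prefix xs ys"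
proof (induction xs arbitrary: c ys)
  case Nil
  have "accumulate c ys = c # tl (accumulate c ys)" by (cases ys) auto
  then show ?case by (metis Nil_prefix accumulate.simps(1) prefix_code(3))
next
  case (Cons x xs)
  show ?case
  proof (cases ys)
    case (Cons y ys')
    have "prefix (accumulate d xs) (accumulate e ys') \<Longrightarrow> d = e" for d e
      by (metis hd_accumulate hd_append2 accumulate_not_Nil(1) prefix_def)
    then show ?thesis using Cons Cons.IH by (cases "x = y") auto
  qed simp
qed

text \<open>Complementation does not change a sum of two letters, so both antimorphisms reverse the
  word of sums. Comparing first letters then decides the parity.\<close>

lemma pal_E_accumulate: "pal anti_E (accumulate c xs) \<longleftrightarrow> rev xs = xs \<and> parity xs"
  by (auto simp: pal_def anti_E_def rev_map[symmetric] rev_accumulate map_Not_accumulate accumulate_inject)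

lemma pal_R_accumulate: "pal anti_R (accumulate c xs) \<longleftrightarrow> rev xs = xs \<and> \<not> parity xs"
  by (auto simp: pal_def anti_R_def rev_accumulate accumulate_inject)

lemma accumulate_sublist:
  assumes "sublist f xs"
  shows "\<exists>c'. sublist (accumulate c' f) (accumulate c xs)"
proof -
  obtain a b where xs: "xs = a @ f @ b" using assms by (auto simp: sublist_def)
  have 1: "\<exists>e. accumulate d (f @ b) = accumulate d f @ e" for d
    by (cases b) (auto simp: accumulate_append)
  show ?thesis
  proof (cases a rule: rev_cases)
    case Nil
    then show ?thesis using 1[of c] xs by (metis append_Nil sublist_def)
  next
    case (snoc a' y)
    then have "accumulate c xs = accumulate c a' @ accumulate ((c \<noteq> parity a') \<noteq> y) (f @ b)"
      using xs by (simp add: accumulate_append)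
    then show ?thesis using 1 by (metis sublist_def)
  qed
qed

section \<open>The palindromic prefixes \<open>p\<^sub>n\<close> and their recurrences\<close>

text \<open>\<open>dprefix n\<close> is \<open>p\<^sub>n\<close>; the value at \<open>n = 0\<close> is a dummy, as \<open>w\<^sub>0\<close> has no letters.
  Overlaps are those of the palindromic closures.\<close>

function dprefix :: "nat \<Rightarrow> bool list" where
  "dprefix n = (if n < 5 then [[], [True], [True, True, True], [True, True, True, True],
      [True, True, True, True, False, True, True, True, True]] ! n
    else if n mod 4 = 1 then dprefix (n - 1) @ [False, True, False] @ dprefix (n - 1)
    else dprefix (n - 1) @ drop (if n mod 4 = 3 then 2 else length (dprefix (n - 4))) (dprefix (n - 1)))"
  by pat_completeness auto
termination by (relation "measure id") auto

declare dprefix.simps [simp del]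

text \<open>The \<open>n\<close> for which \<open>w\<^sub>n\<close> is an E-palindrome; \<open>E_index n\<close> is also the letter following \<open>p\<^sub>n\<close> in \<open>v\<close>.\<close>

definition E_index :: "nat \<Rightarrow> bool" where "E_index n \<longleftrightarrow> n mod 4 = 1 \<or> n mod 4 = 2"

abbreviation dlen :: "nat \<Rightarrow> nat" where "dlen n \<equiv> length (dprefix n)"

text \<open>Two copies of \<open>dprefix n\<close> sharing this many letters make up
  \<open>dprefix (Suc n)\<close> when \<open>n \<ge> 4\<close> is not a multiple of 4. The index is
  that of the word being extended, one less than in the recurrence of
  \<open>dprefix\<close>.\<close>

definition overlap :: "nat \<Rightarrow> nat" where "overlap n = (if n mod 4 = 2 then 2 else dlen (n - 3))"

lemma dprefix_small:
  "dprefix 0 = []" "dprefix (Suc 0) = [True]" "dprefix 2 = [True, True, True]" "dprefix 3 = [True, True, True, True]"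
  "dprefix 4 = [True, True, True, True, False, True, True, True, True]"
  by (simp_all add: dprefix.simps eval_nat_numeral)

lemma dprefix_Suc_0: "n \<ge> 4 \<Longrightarrow> n mod 4 = 0 \<Longrightarrow> dprefix (Suc n) = dprefix n @ [False, True, False] @ dprefix n"
  by (subst dprefix.simps) (auto simp: mod_Suc)

lemma dprefix_Suc: "n \<ge> 4 \<Longrightarrow> n mod 4 \<noteq> 0 \<Longrightarrow> dprefix (Suc n) = dprefix n @ drop (overlap n) (dprefix n)"
proof -
  assume a: "n \<ge> 4" "n mod 4 \<noteq> 0"
  have "Suc n mod 4 \<noteq> 1" "Suc n mod 4 = 3 \<longleftrightarrow> n mod 4 = 2" "Suc n - 4 = n - 3"
    using a by (auto simp: mod_Suc split: if_splits)
  then show ?thesis using a by (subst dprefix.simps) (auto simp: overlap_def)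
qed

lemma prefix_dprefix_Suc: "prefix (dprefix n) (dprefix (Suc n))"
proof (cases "n \<ge> 4")
  case True
  then show ?thesis by (cases "n mod 4 = 0") (auto simp: dprefix_Suc_0 dprefix_Suc)
next
  case False
  then have "n \<in> {0,1,2,3}" by auto
  then show ?thesis by (auto simp: dprefix_small numeral_2_eq_2[symmetric] numeral_3_eq_3[symmetric] simp flip: numeral_2_eq_2)
qed

lemma prefix_dprefix: "m \<le> n \<Longrightarrow> prefix (dprefix m) (dprefix n)"
  by (induction n rule: dec_induct) (auto intro: prefix_dprefix_Suc prefix_order.trans)

text \<open>A palindromic prefix of a palindrome is also its suffix, so \<open>p @ drop k p\<close>
  is \<open>take k p\<close> with mirror images on its two sides.\<close>

lemma rev_append_drop:
  assumes "rev p = p" "rev (take k p) = take k p"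
  shows "rev (p @ drop k p) = p @ drop k p"
proof -
  have "p = rev (drop k p) @ take k p"
    using assms by (metis append_take_drop_id rev_append)
  then show ?thesis
    using assms(1) by (metis append.assoc append_take_drop_id rev_append)
qed

lemma take_prefix_length: "prefix xs ys \<Longrightarrow> take (length xs) ys = xs"
  by (auto simp: prefix_def)

lemma dlen_mono: "m \<le> n \<Longrightarrow> dlen m \<le> dlen n"
  by (intro prefix_length_le prefix_dprefix)

lemma take_overlap:
  assumes "n \<ge> 4"
  shows "take (overlap n) (dprefix n) = (if n mod 4 = 2 then [True, True] else dprefix (n - 3))"
proof (cases "n mod 4 = 2")
  case True
  have "prefix [True, True] (dprefix 2)" by (simp add: dprefix_small)
  then have "prefix [True, True] (dprefix n)"
    using prefix_dprefix[of 2 n] assms by (auto intro: prefix_order.trans)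
  then show ?thesis using take_prefix_length[of "[True, True]"] True by (simp add: overlap_def numeral_2_eq_2)
qed (simp add: overlap_def take_prefix_length prefix_dprefix)

lemma overlap_le: "n \<ge> 4 \<Longrightarrow> overlap n \<le> dlen n"
  using dlen_mono[of 2 n] by (auto simp: overlap_def dprefix_small intro: dlen_mono)

lemma rev_dprefix: "rev (dprefix n) = dprefix n"
proof (induction n rule: less_induct)
  case (less n)
  show ?case
  proof (cases "n < 5")
    case True
    then have "n \<in> {0, Suc 0, 2, 3, 4}" by auto
    then show ?thesis by (auto simp: dprefix_small)
  next
    case False
    then obtain m where n: "n = Suc m" "m \<ge> 4" by (cases n) auto
    have IH: "rev (dprefix m) = dprefix m" "rev (dprefix (m - 3)) = dprefix (m - 3)" using less n by auto
    show ?thesis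
    proof (cases "m mod 4 = 0")
      case True
      then show ?thesis using IH n by (simp add: dprefix_Suc_0)
    next
      case False
      have "rev (dprefix m @ drop (overlap m) (dprefix m)) = dprefix m @ drop (overlap m) (dprefix m)"
        using IH take_overlap[OF n(2)] by (intro rev_append_drop) auto
      then show ?thesis using n False dprefix_Suc[of m] by simp
    qed
  qed
qed

lemma E_index_shift: "n \<ge> 3 \<Longrightarrow> n mod 4 \<noteq> 0 \<Longrightarrow> E_index (n - 3) = E_index (Suc n)"
proof -
  assume "n \<ge> 3"
  then obtain k where "n = k + 3" using le_Suc_ex by (metis add.commute)
  then have "Suc n mod 4 = (n - 3) mod 4" by simp
  then show ?thesis by (simp add: E_index_def)
qed

text \<open>Outside the overlap the two copies cancel modulo 2, so the next word has the parity of
  the overlap. For the overlap \<open>dprefix (n - 3)\<close> this is right because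
  \<open>n - 3\<close> and \<open>n + 1\<close> are congruent modulo 4; the overlap
  \<open>[True, True]\<close> and the middle \<open>[False, True, False]\<close> settle the other
  residues.\<close>

lemma parity_dprefix: "n \<ge> 1 \<Longrightarrow> parity (dprefix n) = E_index n"
proof (induction n rule: less_induct)
  case (less n)
  show ?case
  proof (cases "n < 5")
    case True
    then have "n \<in> {Suc 0, 2, 3, 4}" using less.prems by auto
    then show ?thesis by (auto simp: dprefix_small E_index_def)
  next
    case False
    then obtain m where n: "n = Suc m" "m \<ge> 4" by (cases n) auto
    show ?thesis
    proof (cases "m mod 4 = 0")
      case True
      then show ?thesis using n by (simp add: dprefix_Suc_0 E_index_def mod_Suc)
    next
      case False
      have "parity (dprefix m) = (parity (take (overlap m) (dprefix m)) \<noteq> parity (drop (overlap m) (dprefix m)))"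
        by (metis append_take_drop_id parity_append)
      then have "parity (dprefix n) = parity (take (overlap m) (dprefix m))"
        using n False by (auto simp: dprefix_Suc)
      also have "\<dots> = E_index n"
      proof (cases "m mod 4 = 2")
        case True
        then show ?thesis using n by (simp add: take_overlap E_index_def mod_Suc)
      next
        case False
        then show ?thesis using n less.IH[of "m - 3"] E_index_shift[of m] \<open>m mod 4 \<noteq> 0\<close>
          by (simp add: take_overlap)
      qed
      finally show ?thesis .
    qed
  qed
qed

lemma mod4_cases:
  obtains "n mod 4 = 0" | "n mod 4 = 1" | "n mod 4 = 2" | "n mod 4 = (3::nat)"
proof -
  have "n mod 4 < 4" by simp
  then show thesis using that by linarith
qed

lemma prefix_append_next:
  assumes "prefix (xs @ [c]) p"
  shows "prefix (p @ [c]) (p @ drop (length xs) p)"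
proof -
  obtain zs where "p = (xs @ [c]) @ zs" using assms by (auto simp: prefix_def)
  then have "drop (length xs) p = c # zs" by simp
  then show ?thesis by simp
qed

text \<open>The letter is the sum of the last letter of \<open>w\<^sub>n\<close> and the directive
  letter 1: as \<open>w\<^sub>n\<close> begins with 1, it ends with 0 exactly if it is an
  E-palindrome. When copies overlap, it is the letter after the overlap inside
  \<open>dprefix n\<close>, which is the third letter or known by induction.\<close>

lemma next_dprefix_Suc: "n \<ge> 1 \<Longrightarrow> prefix (dprefix n @ [E_index n]) (dprefix (Suc n))"
proof (induction n rule: less_induct)
  case (less n)
  show ?case
  proof (cases "n < 4")
    case True
    then have "n \<in> {Suc 0, 2, 3}" using less.prems by auto
    then show ?thesis by (auto simp: dprefix_small E_index_def simp flip: numeral_2_eq_2 numeral_3_eq_3)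
  next
    case False
    show ?thesis
    proof (cases "n mod 4 = 0")
      case True
      then show ?thesis using False by (simp add: dprefix_Suc_0 E_index_def)
    next
      case nz: False
      have "prefix (take (overlap n) (dprefix n) @ [E_index n]) (dprefix n) \<and> overlap n = length (take (overlap n) (dprefix n))"
      proof (cases "n mod 4 = 2")
        case True
        have "prefix [True, True, True] (dprefix n)"
          using prefix_dprefix[of 2 n] False by (simp add: dprefix_small)
        then show ?thesis using True by (auto simp: prefix_def numeral_2_eq_2 overlap_def E_index_def)
      next
        case n2: False
        have "prefix (dprefix (n - 3) @ [E_index (n - 3)]) (dprefix (Suc (n - 3)))"
          using False nz by (intro less.IH) (auto intro: Suc_leI)
        also have "prefix \<dots> (dprefix n)" using False by (intro prefix_dprefix) auto
        finally have "prefix (dprefix (n - 3) @ [E_index (n - 3)]) (dprefix n)" .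
        \<comment> \<open>For odd \<open>n\<close>, three steps back in the pattern E, E, R, R lead
          to the same kind.\<close>
        moreover have "E_index (n - 3) = E_index n"
        proof -
          obtain k where "n = k + 3" using False le_Suc_ex[of 3 n] by (auto simp: add.commute)
          then show ?thesis using nz n2
            by (cases k rule: mod4_cases) (auto simp: E_index_def mod_Suc numeral_3_eq_3)
        qed
        moreover have "take (overlap n) (dprefix n) = dprefix (n - 3)" "overlap n = dlen (n - 3)"
          using take_overlap[of n] False n2 by (simp_all add: overlap_def)
        ultimately show ?thesis by simp
      qed
      then have "prefix (dprefix n @ [E_index n]) (dprefix n @ drop (overlap n) (dprefix n))"
        using prefix_append_next by metis
      then show ?thesis using False nz by (simp add: dprefix_Suc)
    qed
  qed
qed

lemma next_dprefix: "1 \<le> m \<Longrightarrow> m < n \<Longrightarrow> prefix (dprefix m @ [E_index m]) (dprefix n)"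
  using next_dprefix_Suc[of m] prefix_dprefix[of "Suc m" n] by (auto intro: prefix_order.trans)

lemma dlen_Suc_0: "n \<ge> 4 \<Longrightarrow> n mod 4 = 0 \<Longrightarrow> dlen (Suc n) = 2 * dlen n + 3"
  by (simp add: dprefix_Suc_0)

lemma dlen_Suc: "n \<ge> 4 \<Longrightarrow> n mod 4 \<noteq> 0 \<Longrightarrow> dlen (Suc n) + overlap n = 2 * dlen n"
  using overlap_le[of n] by (simp add: dprefix_Suc)

lemma dlen_small: "dlen 0 = 0" "dlen (Suc 0) = 1" "dlen 2 = 3" "dlen 3 = 4" "dlen 4 = 9"
  by (simp_all add: dprefix_small)

lemma dlen_strict: "m < n \<Longrightarrow> dlen m < dlen n"
proof -
  assume a: "m < n"
  show "dlen m < dlen n"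
  proof (cases "m = 0")
    case True
    then have "dlen 1 \<le> dlen n" using a by (intro dlen_mono) auto
    then show ?thesis using True by (cases "dprefix n") (auto simp: dlen_small)
  next
    case False
    then show ?thesis using prefix_length_le[OF next_dprefix[of m n]] a by simp
  qed
qed

lemma suffix_dprefix: "m \<le> n \<Longrightarrow> suffix (dprefix m) (dprefix n)"
  using prefix_dprefix[of m n] by (simp add: suffix_to_prefix rev_dprefix)

section \<open>Borders of the palindromic prefixes\<close>

lemma period_iff: "period g xs \<longleftrightarrow> drop g xs = take (length xs - g) xs"
proof
  assume "period g xs"
  then show "drop g xs = take (length xs - g) xs"
    by (intro nth_equalityI) (auto simp: period_def add.commute)
next
  assume *: "drop g xs = take (length xs - g) xs"
  show "period g xs" unfolding period_def
  proof (intro allI impI)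
    fix i assume i: "i + g < length xs"
    have "xs ! (i + g) = drop g xs ! i" using i by (simp add: add.commute)
    also have "\<dots> = xs ! i" using i by (simp add: *)
    finally show "xs ! i = xs ! (i + g)" by simp
  qed
qed

text \<open>Borders are expressed through periods: a period \<open>length zs - b\<close> is a border
  of length \<open>b\<close>. If it is no longer than the border \<open>xs\<close>, it sits at both
  ends of \<open>xs\<close>.\<close>

lemma period_border:
  assumes "prefix xs zs" "suffix xs zs" "b \<le> length xs" "period (length zs - b) zs"
  shows "period (length xs - b) xs"
  unfolding period_def
proof (intro allI impI)
  fix i assume i: "i + (length xs - b) < length xs"
  obtain x y where x: "zs = xs @ x" and y: "zs = y @ xs"
    using assms(1,2) unfolding prefix_def suffix_def by blast
  have "xs ! i = zs ! i" using i by (simp add: x nth_append)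
  also have "\<dots> = zs ! (i + (length zs - b))"
    using assms(3,4) i x unfolding period_def by simp
  also have "i + (length zs - b) = length y + (i + (length xs - b))"
    using assms(3) by (simp add: y)
  also have "zs ! \<dots> = xs ! (i + (length xs - b))"
    by (simp add: y nth_append)
  finally show "xs ! i = xs ! (i + (length xs - b))" .
qed

text \<open>By the recurrence, consecutive lengths of this kind have an even sum. Oddness will
  exclude a divisor equal to half of \<open>dlen n - 2\<close>.\<close>

lemma odd_dlen: "odd (dlen (4 * k + 2))"
proof (induction k)
  case (Suc k)
  have "dlen (Suc (4 * k + 5)) + overlap (4 * k + 5) = 2 * dlen (4 * k + 5)"
    by (intro dlen_Suc) presburger+
  moreover have "overlap (4 * k + 5) = dlen (4 * k + 2)"
    by (simp add: overlap_def)
  ultimately have "dlen (Suc (4 * k + 5)) + dlen (4 * k + 2) = 2 * dlen (4 * k + 5)"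
    by simp
  then have "odd (dlen (Suc (4 * k + 5)))" using Suc by presburger
  then show ?case by (simp add: algebra_simps)
next
  case 0
  show ?case using dlen_small(3) by (simp only: mult_0_right add_0_left) simp
qed

lemma overlap_shift:
  "n \<ge> 5 \<Longrightarrow> (n - 1) mod 4 \<noteq> 2 \<Longrightarrow> overlap (n - 1) = dlen (n - 4)"
  by (simp add: overlap_def)

lemma mod4_pred: "n \<ge> 1 \<Longrightarrow> n mod 4 = Suc ((n - 1) mod 4) mod 4"
  by (cases n) (auto simp: mod_Suc)

lemma dlen_1: "n \<ge> 5 \<Longrightarrow> n mod 4 = 1 \<Longrightarrow> dlen n = 2 * dlen (n - 1) + 3"
  using dlen_Suc_0[of "n - 1"] mod4_pred[of n] by (auto simp: mod_Suc split: if_splits)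

lemma dlen_2: "n \<ge> 5 \<Longrightarrow> n mod 4 = 2 \<Longrightarrow> dlen n + dlen (n - 4) = 2 * dlen (n - 1)"
  using dlen_Suc[of "n - 1"] mod4_pred[of n] overlap_shift[of n] by (auto simp: mod_Suc split: if_splits)

lemma dlen_3: "n \<ge> 5 \<Longrightarrow> n mod 4 = 3 \<Longrightarrow> dlen n + 2 = 2 * dlen (n - 1)"
  using dlen_Suc[of "n - 1"] mod4_pred[of n] by (auto simp: overlap_def mod_Suc split: if_splits)

lemma dlen_0: "n \<ge> 5 \<Longrightarrow> n mod 4 = 0 \<Longrightarrow> dlen n + dlen (n - 4) = 2 * dlen (n - 1)"
  using dlen_Suc[of "n - 1"] mod4_pred[of n] overlap_shift[of n] by (auto simp: mod_Suc split: if_splits)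

lemma mod4_0E:
  assumes "n mod 4 = 0" "n \<ge> 5"
  shows "\<exists>k::nat. n = 8 + 4 * k"
proof -
  obtain j where j: "n = 4 * j" using assms(1) by auto
  then have "2 \<le> j" using assms(2) by simp
  then obtain k where "j = 2 + k" using le_Suc_ex by blast
  then show ?thesis using j by auto
qed

lemma dlen_1_mult: "dlen (4 * k + 5) = 2 * dlen (4 * k + 4) + 3"
proof -
  have "Suc (4 * k + 4) = 4 * k + 5" by simp
  moreover have "(4 * k + 4) mod 4 = 0" by presburger
  ultimately show ?thesis using dlen_Suc_0[of "4 * k + 4"] by (metis le_add2)
qed

lemma dlen_3_mult: "dlen (4 * k + 7) + 2 = 2 * dlen (4 * k + 6)"
proof -
  have "Suc (4 * k + 6) = 4 * k + 7" by simp
  moreover have "(4 * k + 6) mod 4 = 2" by presburger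
  ultimately show ?thesis using dlen_Suc[of "4 * k + 6"] by (simp add: overlap_def add.commute)
qed

text \<open>For Fine and Wilf, \<open>g\<close> and the period \<open>dlen n + 3\<close> must fit
  together into \<open>2 * dlen n + 3\<close> letters. The two values of \<open>g\<close> too large
  for that would match one of the first two letters, both True, with the last False of the middle
  block.\<close>

lemma period_dprefix_le:
  assumes n: "n \<ge> 4" "n mod 4 = 0" and "period g (dprefix (Suc n))" "0 < g" "g < dlen n + 3"
  shows "g \<le> dlen n"
proof (rule ccontr)
  assume "\<not> g \<le> dlen n"
  then have g: "g = dlen n + 1 \<or> g = dlen n + 2" using assms(5) by auto
  have "prefix [True, True] (dprefix n)"
    using prefix_dprefix[of 2 n] n by (auto simp: dprefix_small prefix_def)
  then obtain t where t: "dprefix n = True # True # t" by (auto simp: prefix_def)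
  have pn: "dprefix (Suc n) = dprefix n @ [False, True, False] @ dprefix n" using n by (simp add: dprefix_Suc_0)
  have s: "i + g < dlen (Suc n) \<Longrightarrow> dprefix (Suc n) ! i = dprefix (Suc n) ! (i + g)" for i
    using assms(3) by (simp add: period_def)
  have i0: "dprefix (Suc n) ! 0 = True" "dprefix (Suc n) ! 1 = True"
    by (simp_all add: pn t)
  have i1: "dprefix (Suc n) ! (dlen n) = False" "dprefix (Suc n) ! (dlen n + 2) = False"
    by (simp_all add: pn nth_append del: append_Cons)
  from g show False
  proof
    assume "g = dlen n + 1"
    then show False using s[of 1] i0 i1 pn by simp
  next
    assume "g = dlen n + 2"
    then show False using s[of 0] i0 i1 pn by simp
  qed
qed

text \<open>In terms of borders: no proper border of \<open>dprefix n\<close> is longer than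
  \<open>dprefix (n - 1)\<close>. A period below \<open>q = dlen n - dlen (n - 1)\<close> would by
  Fine and Wilf yield a period \<open>d\<close> that is a proper divisor of \<open>q\<close>.
  Restricting it to \<open>dprefix (n - 1)\<close>, induction gives
  \<open>d \<ge> dlen (n - 1) - dlen (n - 2)\<close>, which the growth of the lengths plays off
  against \<open>2 * d \<le> q\<close>.\<close>

lemma period_dprefix_lower: "n \<ge> 4 \<Longrightarrow> 0 < g \<Longrightarrow> period g (dprefix n) \<Longrightarrow> dlen n \<le> g + dlen (n - 1)"
proof (induction n arbitrary: g rule: less_induct)
  case (less n)
  consider "n = 4" | "n = 5" | "n \<ge> 6" using less.prems by linarith
  then show ?case
  proof cases
    case 1
    show ?thesis
    proof (rule ccontr)
      assume "\<not> ?thesis"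
      then have "g \<in> {1,2,3,4}" using less.prems 1 by (auto simp: dprefix_small)
      then show False using less.prems(3) 1 by (auto simp: dprefix_small period_iff)
    qed
  next
    case 2
    have 5: "dprefix 5 = dprefix 4 @ [False, True, False] @ dprefix 4"
      using dprefix_Suc_0[of 4] by simp
    show ?thesis
    proof (rule ccontr)
      assume "\<not> ?thesis"
      then have "g < 12" using 2 by (simp add: 5 dprefix_small)
      then have "g = 1 \<or> g = 2 \<or> g = 3 \<or> g = 4 \<or> g = 5 \<or> g = 6 \<or> g = 7 \<or> g = 8 \<or> g = 9
          \<or> g = 10 \<or> g = 11"
        using less.prems(2) by presburger
      then show False using less.prems(3) 2 by (elim disjE) (simp_all add: dprefix_small 5 period_iff)
    qed
  next
    case 3
    define m where "m = n - 1"
    have m: "n = Suc m" "m \<ge> 5" using 3 by (auto simp: m_def)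
    let ?P = "dlen m" and ?q = "dlen n - dlen m"
    show ?thesis
    proof (rule ccontr)
      assume "\<not> ?thesis"
      then have g: "g < ?q" using m by simp
      have q: "period ?q (dprefix n)" using m by (intro period_of_border prefix_dprefix suffix_dprefix) auto
      have c: "?P \<le> d + dlen (m - 1)" if "d dvd ?q" "period d (dprefix n)" "0 < d" for d
        using less.IH[of m d] period_prefix[OF that(2) prefix_dprefix[of m n]] m that(3) by auto
      have gle: "g + ?q \<le> dlen n"
      proof (cases "m mod 4 = 0")
        case True
        have "g \<le> ?P" using True m less.prems g dlen_Suc_0[of m] by (intro period_dprefix_le) auto
        then show ?thesis using dlen_strict[of m n] m by simp
      next
        case False
        then show ?thesis using g dlen_Suc[of m] dlen_strict[of m n] m by auto
      qed
      define d where "d = gcd g ?q"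
      have d: "period d (dprefix n)" "d dvd ?q" "0 < d" "d < ?q"
      proof -
        show "period d (dprefix n)" unfolding d_def using less.prems q g gle by (intro period_gcd) auto
        show "d dvd ?q" "0 < d" using less.prems by (auto simp: d_def)
        have "d \<le> g" using less.prems by (auto simp: d_def intro: gcd_le1_nat)
        then show "d < ?q" using g by simp
      qed
      have low: "?P \<le> d + dlen (m - 1)" using c d by auto
      have d2: "2 * d \<le> ?q" using d by (intro dvd_less_mult2) auto
      have "m mod 4 < 4" by simp
      then consider "m mod 4 = 0" | "m mod 4 = 1" | "m mod 4 = 2" | "m mod 4 = 3" by linarith
      then show False
      proof cases
        case m1: 2
        then show False using low d2 dlen_1[of m] dlen_Suc[of m] m by simp
      next
        case m3: 4
        \<comment> \<open>The overlap \<open>dprefix (m - 3)\<close> now has at least 9 letters,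
          more than the 2 letters of overlap in forming \<open>dprefix m\<close>.\<close>
        have "m \<ge> 7" using m3 m by presburger
        then have "dlen 4 \<le> dlen (m - 3)" by (intro dlen_mono) auto
        then show False using low d2 dlen_3[of m] dlen_Suc[of m] m m3 by (simp add: dlen_small overlap_def)
      next
        case m2: 3
        have "m = 4 * (m div 4) + 2" using m2 by presburger
        then obtain k where k: "m = 4 * k + 2" by blast
        have od: "odd ?P" unfolding k by (rule odd_dlen)
        have q: "?q = ?P - 2" using dlen_Suc[of m] m m2 by (simp add: overlap_def)
        have "?P > 2" using dlen_mono[of 2 m] m by (simp add: dlen_small)
        \<comment> \<open>The bound \<open>2 * d \<le> q\<close> is too weak here; oddness improves
          it to \<open>3 * d \<le> q\<close>.\<close>
        then have "?q \<noteq> 2 * d" using od q by presburger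
        then have d3: "3 * d \<le> ?q" using d by (intro dvd_less_mult3) auto
        obtain i where "k = Suc i" using k m(2) by (cases k) auto
        then have km: "m - 1 = 4 * i + 5" "m - 2 = 4 * i + 4" using k by simp_all
        have "dlen (m - 1) = 2 * dlen (m - 2) + 3" unfolding km by (rule dlen_1_mult)
        moreover have "dlen (m - 4) \<le> dlen (m - 2)" by (intro dlen_mono) auto
        moreover have "?P + dlen (m - 4) = 2 * dlen (m - 1)" using m m2 by (intro dlen_2) auto
        moreover have "?q + 2 = ?P" using q \<open>?P > 2\<close> by simp
        ultimately show False using low d3 by linarith
      next
        case m0: 1
        obtain k where k: "m = 8 + 4 * k" using mod4_0E[OF m0 m(2)] by blast
        then have km: "m - 1 = 4 * k + 7" "m - 2 = 4 * k + 6" "m - 3 = 4 * k + 5" "m - 4 = 4 * k + 4"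
          by simp_all
        have q: "?q = ?P + 3" using dlen_Suc_0[of m] m m0 by simp
        have e: "dlen (m - 1) + 2 = 2 * dlen (m - 2)" "dlen (m - 3) = 2 * dlen (m - 4) + 3"
          unfolding km by (rule dlen_3_mult dlen_1_mult)+
        have e': "dlen (m - 3) < dlen (m - 2)" "dlen (m - 2) < dlen (m - 1)" "dlen (m - 1) < dlen m"
          using m(2) by (auto intro: dlen_strict)
        have P: "?P + dlen (m - 4) = 2 * dlen (m - 1)" using m(2) m0 by (intro dlen_0) auto
        \<comment> \<open>Exact halving survives the length estimates here. It would give
          \<open>dprefix m\<close> a border of length \<open>b\<close> with
          \<open>2 * b + 3 = dlen m\<close>, which is then a border of
          \<open>dprefix (m - 1)\<close>, but too long for one.\<close>
        have "?q = 2 * d"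
        proof (rule ccontr)
          assume "?q \<noteq> 2 * d"
          then have "3 * d \<le> ?q" using d by (intro dvd_less_mult3) auto
          then show False using low q P e e' by linarith
        qed
        then have dd: "2 * d = ?P + 3" using q by simp
        define b where "b = ?P - d"
        have b: "2 * b + 3 = ?P" using dd e' by (simp add: b_def)
        have bl: "b < dlen (m - 1)" using b P by linarith
        have perb: "period (?P - b) (dprefix m)"
        proof -
          have "?P - b = d" using b dd by linarith
          then show ?thesis using period_prefix[OF d(1) prefix_dprefix[of m n]] m(1) by simp
        qed
        have "period (dlen (m - 1) - b) (dprefix (m - 1))"
          using bl by (intro period_border[OF _ _ _ perb] prefix_dprefix suffix_dprefix) auto
        then have "dlen (m - 1) \<le> dlen (m - 1) - b + dlen (m - 1 - 1)"
          using m bl k by (intro less.IH) auto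
        moreover have "m - 1 - 1 = m - 2" by simp
        ultimately have "b \<le> dlen (m - 2)" using bl by simp
        then show False using b P e e' by linarith
      qed
    qed
  qed
qed

text \<open>A proper border of \<open>dprefix (Suc n)\<close> is \<open>dprefix n\<close> or a
  proper border of it. The exceptional length 2 stems from \<open>dprefix 3\<close>, four letters
  True, whose borders of lengths 1 and 3 are \<open>dprefix 1\<close> and
  \<open>dprefix 2\<close>.\<close>

lemma border_dprefix:
  assumes "n \<ge> 3" "b < dlen n" "period (dlen n - b) (dprefix n)"
  shows "b = 0 \<or> b = 2 \<or> (\<exists>j. 1 \<le> j \<and> j < n \<and> b = dlen j)"
  using assms
proof (induction n rule: dec_induct)
  case base
  then have "b < 4" by (simp add: dlen_small)
  then consider "b = 0" | "b = 1" | "b = 2" | "b = 3" by linarith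
  then show ?case
  proof cases
    case 2
    then have "b = dlen 1" by (simp add: dlen_small)
    then show ?thesis by (intro disjI2 exI[of _ 1]) simp
  next
    case 4
    then have "b = dlen 2" by (simp add: dlen_small)
    then show ?thesis by (intro disjI2 exI[of _ 2]) simp
  qed simp_all
next
  case (step n)
  have "b \<le> dlen n" using period_dprefix_lower[of "Suc n" "dlen (Suc n) - b"] step by auto
  then consider "b = dlen n" | "b < dlen n" by linarith
  then show ?case
  proof cases
    case 1
    then show ?thesis using step.hyps by (intro disjI2 exI[of _ n]) auto
  next
    case 2
    then have "period (dlen n - b) (dprefix n)"
      by (intro period_border[OF _ _ _ step.prems(2)] prefix_dprefix suffix_dprefix) auto
    then have "b = 0 \<or> b = 2 \<or> (\<exists>j. 1 \<le> j \<and> j < n \<and> b = dlen j)" by (rule step.IH[OF 2])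
    then show ?thesis using less_SucI by blast
  qed
qed

section \<open>Minimality of the palindromic closures\<close>

text \<open>For odd \<open>n\<close>, the two indices before \<open>n\<close> are both of the other
  kind in the pattern E, E, R, R.\<close>

lemma E_index_pred:
  assumes "j < n" "n \<ge> 3" "n mod 4 = 1 \<or> n mod 4 = 3" "E_index j = E_index n"
  shows "j \<le> n - 3"
proof (rule ccontr)
  assume "\<not> j \<le> n - 3"
  then have "n = Suc j \<or> n = Suc (Suc j)" using assms(1,2) by auto
  then show False
    using assms(3,4) by (cases rule: mod4_cases[of j]) (auto simp: E_index_def mod_Suc)
qed

text \<open>A competitor \<open>q\<close> consists of two copies of \<open>dprefix n\<close>
  overlapping in \<open>r\<close> letters, so \<open>r\<close> is one of the known border lengths.
  Moreover the overlap has the parity of \<open>q\<close>, and the letter after it in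
  \<open>dprefix n\<close> is \<open>E_index n\<close>. These conditions force
  \<open>r \<le> overlap n\<close>, and contradict each other if 4 divides \<open>n\<close>.\<close>

lemma dprefix_shortest_overlap:
  assumes n: "n \<ge> 4" and q: "rev q = q" "parity q = E_index (Suc n)" "prefix (dprefix n @ [E_index n]) q"
    and len: "length q \<le> 2 * dlen n"
  shows "dlen (Suc n) \<le> length q"
proof -
  define P where "P = dlen n"
  define r where "r = 2 * P - length q"
  have lq: "P < length q" using prefix_length_le[OF q(3)] by (simp add: P_def)
  have r: "r < P" "length q - P = P - r" "r + length q = 2 * P"
    using lq len by (auto simp: r_def P_def)
  have pq: "prefix (dprefix n) q" using q(3) by (rule append_prefixD)
  then have "prefix (rev (dprefix n)) (rev q)" using q(1) by (simp add: rev_dprefix)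
  then have sq: "suffix (dprefix n) q" using suffix_to_prefix by blast
  have "period (P - r) q" using period_of_border[OF pq sq] r by (simp add: P_def)
  then have period: "period (P - r) (dprefix n)" using pq by (rule period_prefix)
  then have dr: "drop (P - r) (dprefix n) = take r (dprefix n)"
    using r by (simp add: period_iff P_def)
  obtain y where y: "q = y @ dprefix n" using sq by (auto simp: suffix_def)
  have ly: "length y = P - r" using y r by (simp add: P_def)
  have "y = take (P - r) (dprefix n)"
  proof -
    have "y = take (P - r) q" using y ly by simp
    also have "\<dots> = take (P - r) (dprefix n)" using pq by (auto simp: prefix_def P_def)
    finally show ?thesis .
  qed
  then have pn: "dprefix n = y @ take r (dprefix n)" using dr by (metis append_take_drop_id)
  then have "parity (dprefix n) = (parity y \<noteq> parity (take r (dprefix n)))" by (metis parity_append)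
  then have parr: "parity (take r (dprefix n)) = E_index (Suc n)" using q(2) y by auto
  have "q ! P = E_index n" using q(3) by (auto simp: prefix_def P_def nth_append)
  moreover have "q ! P = dprefix n ! r"
  proof -
    have "\<not> P < length y" using ly by linarith
    then have "q ! P = dprefix n ! (P - length y)" unfolding y nth_append by simp
    then show ?thesis using ly r by simp
  qed
  ultimately have lt: "dprefix n ! r = E_index n" by simp
  have "prefix (dprefix 2) (dprefix n)" using n by (intro prefix_dprefix) auto
  then have t2: "take 2 (dprefix n) = [True, True]" "dprefix n ! 2 = True"
    by (auto simp: prefix_def dprefix_small)
  have ov2: "2 \<le> overlap n" if "n mod 4 \<noteq> 0"
  proof (cases "n mod 4 = 2")
    case False
    have "n \<noteq> 4" using that by auto
    then have "dlen 2 \<le> dlen (n - 3)" using n by (intro dlen_mono) auto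
    then show ?thesis using False by (simp add: overlap_def dlen_small)
  qed (simp add: overlap_def)
  have E0: "E_index (Suc n)" if "n mod 4 = 0" using that by (simp add: E_index_def mod_Suc)
  consider "r = 0" | "r = 2" | j where "1 \<le> j" "j < n" "r = dlen j"
    using border_dprefix[of n r] n r period by (auto simp: P_def)
  then have "n mod 4 \<noteq> 0 \<and> r \<le> overlap n"
  proof cases
    case 1
    then have "\<not> E_index (Suc n)" using parr by simp
    then show ?thesis using 1 E0 by auto
  next
    case 2
    then have "\<not> E_index (Suc n)" using parr t2 by simp
    then show ?thesis using 2 ov2 E0 by blast
  next
    case 3
    have pj: "prefix (dprefix j @ [E_index j]) (dprefix n)" using 3 by (intro next_dprefix) auto
    have "take r (dprefix n) = dprefix j" using 3 prefix_dprefix[of j n] by (simp add: take_prefix_length)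
    then have j1: "E_index j = E_index (Suc n)" using parr 3 parity_dprefix[of j] by simp
    have "dprefix n ! r = E_index j" using pj 3 by (auto simp: prefix_def nth_append)
    then have j2: "E_index j = E_index n" using lt by simp
    \<comment> \<open>A border \<open>dprefix j\<close> qualifies only if \<open>n\<close> and
      \<open>Suc n\<close> are of the same kind, that is, if \<open>n\<close> is odd.\<close>
    then have nm: "n mod 4 = 1 \<or> n mod 4 = 3"
      using j1 by (cases n rule: mod4_cases) (auto simp: E_index_def mod_Suc)
    then have "j \<le> n - 3" using E_index_pred[of j n] 3 j2 n by simp
    then have "dlen j \<le> dlen (n - 3)" by (rule dlen_mono)
    then show ?thesis using nm 3 by (auto simp: overlap_def)
  qed
  then show ?thesis using dlen_Suc[of n] n r by (simp add: P_def)
qed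

lemma dprefix_shortest:
  assumes n: "n \<ge> 1" and q: "rev q = q" "parity q = E_index (Suc n)" "prefix (dprefix n @ [E_index n]) q"
  shows "dlen (Suc n) \<le> length q"
proof -
  consider "n = 1" | "n = 2" | "n = 3" | "n \<ge> 4" using n by linarith
  then show ?thesis
  proof cases
    case 1
    then have "prefix [True, True] q" using q by (simp add: dprefix_small E_index_def)
    then obtain t where t: "q = True # True # t" by (auto simp: prefix_def)
    then have "t \<noteq> []" using q(2) 1 by (auto simp: E_index_def)
    then show ?thesis using t 1 by (cases t) (auto simp: dlen_small simp flip: numeral_2_eq_2)
  next
    case 2
    then show ?thesis using prefix_length_le[OF q(3)]
      by (simp add: dlen_small flip: numeral_2_eq_2 numeral_3_eq_3)
  next
    case 3
    then have "prefix [True, True, True, True, False] q" using q by (simp add: dprefix_small E_index_def)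
    then obtain t where t: "q = [True, True, True, True, False] @ t" by (auto simp: prefix_def)
    \<comment> \<open>The False at position 4 has its mirror image at position
      \<open>length t\<close>, but the first four letters are True.\<close>
    have "length t \<ge> 4"
    proof (rule ccontr)
      assume "\<not> length t \<ge> 4"
      then have "length t < 4" by simp
      moreover have "False = q ! 4" using t by simp
      moreover have "q ! 4 = q ! (length q - 1 - 4)"
        using t rev_nth[of 4 q] q(1) by (simp add: numeral_eq_Suc)
      moreover have "length q - 1 - 4 = length t" using t by simp
      ultimately have "q ! length t = False" by simp
      moreover have "length t = 0 \<or> length t = 1 \<or> length t = 2 \<or> length t = 3"
        using \<open>length t < 4\<close> by linarith
      ultimately show False using t by (auto simp: nth_Cons split: nat.splits)
    qed
    then show ?thesis using t 3 dlen_small(5) by simp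
  next
    case 4
    show ?thesis
    proof (cases "length q \<le> 2 * dlen n")
      case True
      then show ?thesis using dprefix_shortest_overlap 4 q by blast
    next
      case False
      have pq: "prefix (dprefix n) q" using q(3) by (rule append_prefixD)
      then have "prefix (rev (dprefix n)) (rev q)" using q(1) by (simp add: rev_dprefix)
      then have sq: "suffix (dprefix n) q" using suffix_to_prefix by blast
      obtain z where z: "q = dprefix n @ z" using pq by (auto simp: prefix_def)
      have "suffix (dprefix n) z"
        using sq False unfolding z by (auto simp: suffix_append dest: suffix_length_le)
      then obtain m where m: "q = dprefix n @ m @ dprefix n" using z by (auto simp: suffix_def)
      have "m \<noteq> []" using m False by auto
      then obtain c m' where c: "m = c # m'" by (cases m) auto
      then have "c = E_index n" using q(3) m by (auto simp: prefix_def)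
      have pm: "parity m = E_index (Suc n)" using m q(2) by auto
      have rm: "rev m = m" using q(1) m by (simp add: rev_dprefix)
      show ?thesis
      proof (cases "n mod 4 = 0")
        case True
        then have ct: "c = False" "parity m" using \<open>c = E_index n\<close> pm by (auto simp: E_index_def mod_Suc)
        \<comment> \<open>The middle block is a palindrome of odd parity starting with False; the
          shortest such word is \<open>[False, True, False]\<close>.\<close>
        have "length m \<ge> 3"
        proof (rule ccontr)
          assume "\<not> length m \<ge> 3"
          then have "length m' \<le> 1" using c by auto
          then have "m' = [] \<or> (\<exists>d. m' = [d])" by (cases m') auto
          then show False using ct c rm by auto
        qed
        then show ?thesis using m dlen_Suc_0[of n] True 4 by simp
      next
        case nz: False
        then show ?thesis using dlen_Suc[of n] False 4 by simp
      qed
    qed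
  qed
qed

text \<open>Under \<open>accumulate True\<close>, closure for either antimorphism becomes the search
  for the shortest palindrome of prescribed parity, settled by \<open>dprefix_shortest\<close>. The
  induction starts at 1 because \<open>accumulate\<close> never yields the empty word
  \<open>w\<^sub>0\<close>.\<close>

lemma gps_prefix_eq: "n \<ge> 1 \<Longrightarrow> gps_prefix (\<lambda>_. True) EERR n = accumulate True (dprefix n)"
proof (induction n rule: dec_induct)
  case base
  have "gps_prefix (\<lambda>_. True) EERR 1 = closure anti_E [True]" by (simp add: EERR_def)
  also have "\<dots> = accumulate True (dprefix 1)"
  proof (rule closure_eqI)
    show "pal anti_E (accumulate True (dprefix 1))" by (simp only: pal_E_accumulate rev_dprefix parity_dprefix) (simp add: E_index_def)
    show "prefix [True] (accumulate True (dprefix 1))" by (simp add: dprefix_small)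
    fix q assume "pal anti_E q" "prefix [True] q"
    then show "length (accumulate True (dprefix 1)) \<le> length q"
      by (cases q; cases "tl q") (auto simp: pal_def anti_E_def dprefix_small)
  qed simp
  finally show ?case .
next
  case (step n)
  define \<theta> where "\<theta> = EERR n"
  have \<theta>: "\<theta> = (if E_index (Suc n) then anti_E else anti_R)"
    by (cases n rule: mod4_cases) (auto simp: \<theta>_def EERR_def E_index_def mod_Suc)
  have pal: "pal \<theta> (accumulate c xs) \<longleftrightarrow> rev xs = xs \<and> parity xs = E_index (Suc n)" for c xs
    by (simp add: \<theta> pal_E_accumulate pal_R_accumulate)
  have ext: "accumulate True (dprefix n) @ [True] = accumulate True (dprefix n @ [E_index n])"
    using step.hyps parity_dprefix[of n] by (cases "E_index n") (simp_all add: accumulate_append)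
  have "gps_prefix (\<lambda>_. True) EERR (Suc n) = closure \<theta> (accumulate True (dprefix n @ [E_index n]))"
    using step.IH ext by (simp add: \<theta>_def)
  also have "\<dots> = accumulate True (dprefix (Suc n))"
  proof (rule closure_eqI)
    show "\<theta> \<in> {anti_E, anti_R}" by (simp add: \<theta>)
    show "pal \<theta> (accumulate True (dprefix (Suc n)))" by (simp add: pal rev_dprefix parity_dprefix)
    show "prefix (accumulate True (dprefix n @ [E_index n])) (accumulate True (dprefix (Suc n)))"
      using step.hyps by (simp only: prefix_accumulate next_dprefix_Suc)
    fix q assume q: "pal \<theta> q" "prefix (accumulate True (dprefix n @ [E_index n])) q"
    then have "q \<noteq> []" by (auto)
    then obtain r where r: "q = accumulate (hd q) r" using accumulate_exhaust by blast
    have "hd q = True" using q(2) by (metis hd_append2 hd_accumulate accumulate_not_Nil(1) prefix_def)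
    then have r: "q = accumulate True r" using r by simp
    then show "length (accumulate True (dprefix (Suc n))) \<le> length q"
      using q step.hyps dprefix_shortest[of n r] by (simp add: pal prefix_accumulate)
  qed
  finally show ?case .
qed

section \<open>Factors of \<open>v\<close> and of \<open>u_p\<close>\<close>

definition dfactors :: "nat \<Rightarrow> bool list set" where
  "dfactors n = {f. length f = n \<and> (\<exists>m. sublist f (dprefix m))}"

lemma finite_dfactors: "finite (dfactors n)"
  by (rule finite_subset[OF _ finite_lists_length_eq[of UNIV n]]) (auto simp: dfactors_def)

lemma sublist_rev_dprefix: "sublist f (dprefix m) \<Longrightarrow> sublist (rev f) (dprefix m)"
  by (metis rev_dprefix sublist_rev)

lemma EERR_in: "EERR n \<in> {anti_E, anti_R}"
  by (cases n rule: mod4_cases) (auto simp: EERR_def)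

lemma sublist_factors:
  assumes "m \<ge> 1" "sublist g (accumulate True (dprefix m))"
  shows "g \<in> factors u_p (length g)"
proof -
  define w where "w = gps_prefix (\<lambda>_. True) EERR m"
  have w: "map u_p [0..<length w] = w"
    using gps_word_prefix[of EERR "\<lambda>_. True" m, OF EERR_in] by (simp add: u_p_def w_def)
  obtain a b where ab: "w = a @ g @ b"
    using assms gps_prefix_eq[of m] unfolding w_def sublist_def by auto
  have "g = take (length g) (drop (length a) (map u_p [0..<length w]))"
    unfolding w by (simp add: ab)
  also have "\<dots> = map u_p [length a..<length a + length g]"
    by (simp add: drop_map take_map ab)
  finally show ?thesis unfolding factors_def by blast
qed

lemma sublist_accumulate_mono:
  "m \<le> n \<Longrightarrow> sublist g (accumulate c (dprefix m)) \<Longrightarrow> sublist g (accumulate c (dprefix n))"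
  using prefix_dprefix[of m n] prefix_accumulate[of c "dprefix m" "dprefix n"]
  by (meson prefix_imp_sublist sublist_order.order.trans)

lemma sublist_map_Not: "sublist xs ys \<Longrightarrow> sublist (map Not xs) (map Not ys)"
  unfolding sublist_def by (metis map_append)

text \<open>An E-palindromic prefix also contains the complement of the factor reversed, and a
  longer R-palindromic prefix undoes the reversal. The indices \<open>4 * m + 1\<close> and
  \<open>4 * m + 3\<close> provide such prefixes beyond any \<open>m\<close>.\<close>

lemma sublist_accumulate_Not:
  assumes "sublist (accumulate c f) (accumulate True (dprefix m))"
  shows "\<exists>m'\<ge>1. sublist (accumulate (\<not> c) f) (accumulate True (dprefix m'))"
proof -
  define k l where "k = 4 * m + 1" and "l = 4 * m + 3"
  have kl: "E_index k" "\<not> E_index l" "k \<ge> 1" "l \<ge> 1" "m \<le> k" "k \<le> l"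
    by (auto simp: k_def l_def E_index_def mod_Suc)
  have k: "rev (map Not (accumulate True (dprefix k))) = accumulate True (dprefix k)"
    using kl by (simp add: map_Not_accumulate rev_accumulate rev_dprefix parity_dprefix)
  have l: "rev (accumulate True (dprefix l)) = accumulate True (dprefix l)"
    using kl by (simp add: rev_accumulate rev_dprefix parity_dprefix)
  have "sublist (accumulate c f) (accumulate True (dprefix k))"
    using kl(5) assms by (rule sublist_accumulate_mono)
  then have "sublist (rev (map Not (accumulate c f))) (rev (map Not (accumulate True (dprefix k))))"
    by (simp add: sublist_map_Not)
  then have "sublist (rev (accumulate (\<not> c) f)) (accumulate True (dprefix k))"
    unfolding k by (simp add: map_Not_accumulate)
  then have "sublist (rev (accumulate (\<not> c) f)) (accumulate True (dprefix l))"
    using kl(6) sublist_accumulate_mono by blast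
  then have "sublist (rev (accumulate (\<not> c) f)) (rev (accumulate True (dprefix l)))"
    by (simp only: l)
  then have "sublist (accumulate (\<not> c) f) (accumulate True (dprefix l))" by simp
  then show ?thesis using kl(4) by blast
qed

text \<open>Each factor of \<open>v\<close> lifts to two factors of \<open>u_p\<close>, one for each
  first letter.\<close>

lemma card_dfactors_complexity: "2 * card (dfactors n) \<le> factor_complexity u_p (Suc n)"
proof -
  let ?h = "\<lambda>(c, f). accumulate c f"
  have "?h ` (UNIV \<times> dfactors n) \<subseteq> factors u_p (Suc n)"
  proof clarify
    fix c f assume f: "f \<in> dfactors n"
    then obtain m where m: "sublist f (dprefix m)" "length f = n" by (auto simp: dfactors_def)
    \<comment> \<open>Passing to \<open>Suc m\<close> avoids the dummy index 0.\<close>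
    then have "sublist f (dprefix (Suc m))" using prefix_dprefix_Suc by (meson prefix_imp_sublist sublist_order.order.trans)
    then obtain c' where c': "sublist (accumulate c' f) (accumulate True (dprefix (Suc m)))" using accumulate_sublist by blast
    have "\<exists>m'\<ge>1. sublist (accumulate c f) (accumulate True (dprefix m'))"
    proof (cases "c = c'")
      case True
      then show ?thesis using c' by (intro exI[of _ "Suc m"]) auto
    next
      case False
      then have "c = (\<not> c')" by auto
      then show ?thesis using sublist_accumulate_Not[OF c'] by simp
    qed
    then show "accumulate c f \<in> factors u_p (Suc n)" using sublist_factors m(2) by fastforce
  qed
  moreover have "finite (factors u_p (Suc n))"
    by (rule finite_subset[OF _ finite_lists_length_eq[of UNIV "Suc n"]]) (auto simp: factors_def)
  ultimately have "card (?h ` (UNIV \<times> dfactors n)) \<le> factor_complexity u_p (Suc n)"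
    unfolding factor_complexity_def by (rule card_mono[rotated])
  moreover have "inj_on ?h (UNIV \<times> dfactors n)" by (auto simp: inj_on_def accumulate_inject)
  ultimately show ?thesis by (simp add: card_image card_cartesian_product)
qed

section \<open>Right special factors\<close>

definition right_special :: "bool list \<Rightarrow> bool" where
  "right_special f \<longleftrightarrow> (\<forall>c. \<exists>m. sublist (f @ [c]) (dprefix m))"

lemma dfactors_extend:
  assumes "sublist f (dprefix m)"
  shows "\<exists>c m. sublist (f @ [c]) (dprefix m)"
proof -
  obtain a b where ab: "dprefix m = a @ f @ b" using assms by (auto simp: sublist_def)
  obtain z where z: "dprefix (Suc m) = dprefix m @ z" using prefix_dprefix_Suc by (auto simp: prefix_def)
  have "z \<noteq> []" using z dlen_strict[of m "Suc m"] by auto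
  then obtain c y where "b @ z = c # y" by (cases "b @ z") auto
  then have "dprefix (Suc m) = a @ (f @ [c]) @ y" using z ab by simp
  then show ?thesis unfolding sublist_def by blast
qed

text \<open>The factors of length \<open>Suc n\<close> are split by their last letter into
  \<open>A True\<close> and \<open>A False\<close>. The union of these contains all factors of
  length \<open>n\<close>, the intersection all right special ones.\<close>

lemma card_dfactors_Suc:
  assumes "\<And>f. f \<in> S \<Longrightarrow> length f = n \<and> right_special f"
  shows "card (dfactors n) + card S \<le> card (dfactors (Suc n))"
proof -
  define A where "A c = {f. f @ [c] \<in> dfactors (Suc n)}" for c
  have fin: "finite (A c)" for c
    by (rule finite_subset[OF _ finite_lists_length_eq[of UNIV n]]) (auto simp: A_def dfactors_def)
  have "dfactors n \<subseteq> A True \<union> A False"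
  proof
    fix f assume f: "f \<in> dfactors n"
    then obtain c m where "sublist (f @ [c]) (dprefix m)" using dfactors_extend unfolding dfactors_def by blast
    then have "f \<in> A c" using f by (auto simp: A_def dfactors_def)
    then show "f \<in> A True \<union> A False" by (cases c) auto
  qed
  then have 1: "card (dfactors n) \<le> card (A True \<union> A False)" by (intro card_mono) (auto simp: fin)
  have "S \<subseteq> A True \<inter> A False" using assms by (auto simp: A_def dfactors_def right_special_def)
  then have 2: "card S \<le> card (A True \<inter> A False)" by (intro card_mono) (auto simp: fin)
  have "card (A True) + card (A False)
      = card ((\<lambda>f. f @ [True]) ` A True) + card ((\<lambda>f. f @ [False]) ` A False)"
    by (simp add: card_image inj_on_def)
  also have "\<dots> = card ((\<lambda>f. f @ [True]) ` A True \<union> (\<lambda>f. f @ [False]) ` A False)"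
    by (intro card_Un_disjoint[symmetric]) (auto simp: fin)
  also have "\<dots> \<le> card (dfactors (Suc n))"
    by (intro card_mono finite_dfactors) (auto simp: A_def)
  finally show ?thesis using 1 2 card_Un_Int[of "A True" "A False"] fin by simp
qed

lemma right_special_suffix: "right_special g \<Longrightarrow> suffix f g \<Longrightarrow> right_special f"
  unfolding right_special_def by (metis append.assoc sublist_append_leftI sublist_order.order.trans suffix_def)

text \<open>Being a suffix of every later \<open>dprefix k\<close>, the word can be followed by
  \<open>E_index k\<close>, which takes both values.\<close>

lemma right_special_dprefix: "right_special (dprefix j)"
  unfolding right_special_def
proof
  fix c
  define k where "k = 4 * j + (if c then 1 else 3)"
  have k: "E_index k = c" "j \<le> k" "k \<ge> 1" by (auto simp: k_def E_index_def mod_Suc)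
  have "sublist (dprefix j @ [c]) (dprefix k @ [c])"
    using suffix_dprefix[OF k(2)] unfolding suffix_def sublist_def by (metis append.assoc append_Nil2)
  also have "sublist \<dots> (dprefix (Suc k))"
    using next_dprefix_Suc[OF k(3)] k(1) by simp
  finally show "\<exists>m. sublist (dprefix j @ [c]) (dprefix m)" ..
qed

definition increment :: "nat \<Rightarrow> bool list" where
  "increment j = drop (dlen (j - 1)) (dprefix j)"

text \<open>The palindrome \<open>b\<^sub>j\<close>.\<close>

definition bispecial :: "nat \<Rightarrow> bool list" where
  "bispecial j = rev (increment j) @ dprefix (j + 2) @ increment j"

lemma dprefix_increment: "dprefix j = dprefix (j - 1) @ increment j"
  using prefix_dprefix[of "j - 1" j] by (auto simp: increment_def prefix_def)

lemma rev_bispecial: "rev (bispecial j) = bispecial j"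
  by (simp add: bispecial_def rev_dprefix)

lemma length_bispecial: "length (bispecial j) + 2 * dlen (j - 1) = dlen (j + 2) + 2 * dlen j"
proof -
  have "dlen j = dlen (j - 1) + length (increment j)" using arg_cong[OF dprefix_increment[of j], of length] by simp
  then show ?thesis by (simp add: bispecial_def)
qed

lemma E_index_odd_pred: "odd j \<Longrightarrow> E_index (j - 1) = (\<not> E_index j)"
  by (cases j; cases "j - 1" rule: mod4_cases) (auto simp: E_index_def mod_Suc split: if_splits, presburger+)

text \<open>For odd \<open>j\<close> the steps to \<open>j\<close> and to \<open>j + 4\<close>
  follow the same rule, inserting \<open>[False, True, False]\<close> or overlapping in two letters.
  So what is appended to \<open>dprefix (j + 3)\<close> starts with \<open>increment j\<close> and
  goes on with the letter that follows \<open>dprefix (j - 1)\<close>.\<close>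

lemma increment_next:
  assumes "odd j" "j \<ge> 5"
  shows "prefix (dprefix (j + 3) @ increment j @ [E_index (j - 1)]) (dprefix (j + 4))"
proof -
  obtain i where i: "j = Suc i" "i \<ge> 4" "even i" using assms by (cases j) auto
  have nx: "prefix (dprefix i @ [E_index i]) (dprefix (i + 4))" using i by (intro next_dprefix) auto
  have e: "j + 4 = Suc (i + 4)" "j + 3 = i + 4" "j - 1 = i" using i by simp_all
  show ?thesis
  proof (cases "i mod 4 = 0")
    case True
    have "increment j = [False, True, False] @ dprefix i" using i True by (simp add: increment_def dprefix_Suc_0)
    moreover have "dprefix (Suc (i + 4)) = dprefix (i + 4) @ [False, True, False] @ dprefix (i + 4)"
      using i True by (intro dprefix_Suc_0) auto
    ultimately show ?thesis using nx unfolding e by simp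
  next
    case False
    then have m2: "i mod 4 = 2" using i(3) by presburger
    have y: "increment j = drop 2 (dprefix i)" using i m2 by (simp add: increment_def dprefix_Suc overlap_def)
    have "dprefix (Suc (i + 4)) = dprefix (i + 4) @ drop 2 (dprefix (i + 4))"
      using i m2 by (subst dprefix_Suc) (auto simp: overlap_def)
    moreover have "prefix (drop 2 (dprefix i) @ [E_index i]) (drop 2 (dprefix (i + 4)))"
    proof -
      have "2 \<le> dlen i" using dlen_mono[of 2 i] i by (simp add: dlen_small)
      then show ?thesis using nx by (auto simp: prefix_def)
    qed
    ultimately show ?thesis using y unfolding e by simp
  qed
qed

text \<open>For odd \<open>j\<close>, \<open>dprefix (j + 3)\<close> is made of two copies of
  \<open>dprefix (j + 2)\<close> overlapping in \<open>dprefix (j - 1)\<close>. So the first copy is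
  followed by what follows \<open>dprefix (j - 1)\<close>, namely \<open>increment j\<close> and
  \<open>E_index j\<close>; the lemma is the mirror image.\<close>

lemma increment_suffix:
  assumes "odd j" "j \<ge> 5"
  shows "suffix (E_index j # rev (increment j) @ dprefix (j + 2)) (dprefix (j + 3))"
proof -
  have "(j + 2) mod 4 \<noteq> 0" "(j + 2) mod 4 \<noteq> 2" using assms(1) by presburger+
  moreover have "j + 2 - 3 = j - 1" by simp
  ultimately have "overlap (j + 2) = dlen (j - 1)" "(j + 2) mod 4 \<noteq> 0"
    by (simp_all only: overlap_def if_False simp_thms)
  then have "dprefix (Suc (j + 2)) = dprefix (j + 2) @ drop (dlen (j - 1)) (dprefix (j + 2))"
    using assms(2) dprefix_Suc[of "j + 2"] by (simp del: add_2_eq_Suc')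
  moreover have "prefix (increment j @ [E_index j]) (drop (dlen (j - 1)) (dprefix (j + 2)))"
  proof -
    have "prefix (dprefix j @ [E_index j]) (dprefix (j + 2))" using assms by (intro next_dprefix) auto
    then obtain z where "dprefix (j + 2) = (dprefix j @ [E_index j]) @ z" by (auto simp only: prefix_def)
    then have "dprefix (j + 2) = dprefix (j - 1) @ (increment j @ [E_index j]) @ z"
      using dprefix_increment[of j] by (metis append.assoc)
    then have "drop (dlen (j - 1)) (dprefix (j + 2)) = (increment j @ [E_index j]) @ z"
      by (metis append_eq_conv_conj)
    then show ?thesis by (simp only: prefixI)
  qed
  moreover have "Suc (j + 2) = j + 3" by simp
  ultimately have "prefix (dprefix (j + 2) @ increment j @ [E_index j]) (dprefix (j + 3))"
    by (metis same_prefix_prefix)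
  then have "prefix (rev (E_index j # rev (increment j) @ dprefix (j + 2))) (rev (dprefix (j + 3)))"
    by (simp add: rev_dprefix)
  then show ?thesis using suffix_to_prefix by blast
qed

text \<open>The two preceding lemmas put the palindrome \<open>bispecial j\<close> between two
  different letters. Reversal exchanges these, so both can follow it.\<close>

lemma right_special_bispecial:
  assumes "odd j" "j \<ge> 5"
  shows "right_special (bispecial j)"
proof -
  have 1: "sublist (E_index j # bispecial j @ [\<not> E_index j]) (dprefix (j + 4))"
  proof -
    have "suffix (E_index j # bispecial j @ [\<not> E_index j]) (dprefix (j + 3) @ increment j @ [E_index (j - 1)])"
      using increment_suffix[OF assms] E_index_odd_pred[OF assms(1)] by (auto simp: bispecial_def suffix_def)
    then show ?thesis using increment_next[OF assms]
      by (meson prefix_imp_sublist sublist_order.order.trans suffix_imp_sublist)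
  qed
  have "sublist (bispecial j @ [\<not> E_index j]) (dprefix (j + 4))"
    using 1 by (metis append_Cons append_Nil sublist_append_leftI sublist_order.order.trans)
  moreover have "sublist (E_index j # bispecial j) (dprefix (j + 4))"
    using 1 by (metis append_Cons sublist_append_rightI sublist_order.order.trans)
  then have "sublist (bispecial j @ [E_index j]) (dprefix (j + 4))"
    using sublist_rev_dprefix[of "E_index j # bispecial j"] by (simp add: rev_bispecial)
  ultimately have "\<exists>m. sublist (bispecial j @ [c]) (dprefix m)" for c by (cases "c = E_index j") auto
  then show ?thesis by (simp add: right_special_def)
qed

lemma dprefix_suffix_next: "1 \<le> m \<Longrightarrow> m < n \<Longrightarrow> suffix (E_index m # dprefix m) (dprefix n)"
  using next_dprefix[of m n] by (simp add: suffix_to_prefix rev_dprefix)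

text \<open>The letter is the one before the suffix \<open>dprefix (j - 1)\<close> of
  \<open>dprefix (j + 2)\<close>. At the end of a longer \<open>dprefix n\<close>, however,
  \<open>dprefix j\<close> is preceded by \<open>E_index j\<close>, so suffixes of the two kinds
  differ once they are longer than \<open>dprefix j\<close>.\<close>

lemma bispecial_suffix:
  assumes "odd j" "j \<ge> 5"
  shows "suffix ((\<not> E_index j) # dprefix j) (bispecial j)"
proof -
  have "suffix (E_index (j - 1) # dprefix (j - 1)) (dprefix (j + 2))" using assms by (intro dprefix_suffix_next) auto
  then have "suffix ((E_index (j - 1) # dprefix (j - 1)) @ increment j) (dprefix (j + 2) @ increment j)"
    by (auto simp: suffix_def)
  then have "suffix (E_index (j - 1) # dprefix j) (dprefix (j + 2) @ increment j)" using dprefix_increment[of j] by simp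
  then show ?thesis using E_index_odd_pred[OF assms(1)] by (simp add: bispecial_def suffix_append)
qed

definition sfx :: "nat \<Rightarrow> bool list \<Rightarrow> bool list" where
  "sfx n xs = drop (length xs - n) xs"

lemma sfx: "suffix (sfx n xs) xs" "n \<le> length xs \<Longrightarrow> length (sfx n xs) = n"
  by (auto simp: sfx_def suffix_drop)

lemma sfx_suffix: "suffix ys xs \<Longrightarrow> length ys \<le> n \<Longrightarrow> suffix ys (sfx n xs)"
  by (rule suffix_length_suffix[OF _ sfx(1)]) (auto simp: sfx_def dest: suffix_length_le)

lemma suffix_same: "suffix (a # ys) xs \<Longrightarrow> suffix (b # ys) xs \<Longrightarrow> a = b"
  by (auto simp: suffix_def)

lemma le_dlen: "n \<le> dlen n"
proof (induction n)
  case (Suc n)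
  then show ?case using dlen_strict[of n "Suc n"] by simp
qed simp

text \<open>For odd \<open>j\<close> the step to \<open>j + 2\<close> overlaps in two letters or not
  at all. This will bound \<open>bispecial j\<close> by \<open>dlen (j + 4)\<close>, where the next
  range with three right special factors begins.\<close>

lemma dlen_double:
  assumes "odd j" "j \<ge> 3"
  shows "2 * dlen j \<le> dlen (j + 2)"
proof -
  have "dlen j < dlen (j + 1)" by (rule dlen_strict) simp
  moreover have "2 * dlen (j + 1) \<le> dlen (j + 2) + 2"
  proof (cases "(j + 2) mod 4 = 1")
    case True
    then show ?thesis using dlen_1[of "j + 2"] assms by simp
  next
    case False
    then have "(j + 2) mod 4 = 3" using assms(1) by presburger
    then show ?thesis using dlen_3[of "j + 2"] assms by simp
  qed
  ultimately show ?thesis by simp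
qed

lemma length_bispecial_le:
  assumes "odd j" "j \<ge> 3"
  shows "length (bispecial j) \<le> dlen (j + 4)"
proof -
  have e: "j + 2 + 2 = j + 4" by simp
  have "2 * dlen (j + 2) \<le> dlen (j + 4)"
    using assms by (intro dlen_double[of "j + 2", unfolded e]) auto
  then show ?thesis using dlen_double[OF assms] length_bispecial[of j] by linarith
qed

text \<open>The letter before \<open>dprefix j\<close> separates suffixes of
  \<open>dprefix N\<close> from those of \<open>bispecial j\<close>. The suffix of
  \<open>bispecial (j + 2)\<close> agrees there with that of \<open>dprefix N\<close>, but differs
  from it in the letter before \<open>dprefix (j + 2)\<close>.\<close>

lemma card_dfactors_Suc_ge:
  assumes j: "odd j" "j \<ge> 5" and n: "dlen j < n" "n \<le> length (bispecial j)"
  shows "card (dfactors n) + 2 \<le> card (dfactors (Suc n))"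
    and "dlen (j + 2) < n \<Longrightarrow> card (dfactors n) + 3 \<le> card (dfactors (Suc n))"
proof -
  obtain N where N: "n \<le> dlen N" "j + 2 < N"
    using le_dlen[of "n + j + 3"] by (intro that[of "n + j + 3"]) auto
  let ?a = "sfx n (dprefix N)" and ?b = "sfx n (bispecial j)" and ?c = "sfx n (bispecial (j + 2))"
  have a: "length ?a = n" "right_special ?a" using sfx N right_special_dprefix right_special_suffix by blast+
  have b: "length ?b = n" "right_special ?b" using sfx n right_special_bispecial[OF j] right_special_suffix by blast+
  have as: "suffix (E_index j # dprefix j) ?a" using j n N by (intro sfx_suffix dprefix_suffix_next) auto
  have bs: "suffix ((\<not> E_index j) # dprefix j) ?b" by (rule sfx_suffix[OF bispecial_suffix[OF j]]) (use n in simp)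
  have ab: "?a \<noteq> ?b" using as bs suffix_same by metis
  have "card (dfactors n) + card {?a, ?b} \<le> card (dfactors (Suc n))"
    by (intro card_dfactors_Suc) (use a b in auto)
  then show "card (dfactors n) + 2 \<le> card (dfactors (Suc n))" using ab by simp
  assume n2: "dlen (j + 2) < n"
  have j2: "odd (j + 2)" "j + 2 \<ge> 5" using j by auto
  have "length (bispecial j) \<le> dlen (j + 4)" using j by (intro length_bispecial_le) auto
  moreover have "dlen (j + 2 - 1) \<le> dlen (j + 2)" by (rule dlen_mono) simp
  moreover have e: "j + 2 + 2 = j + 4" by simp
  ultimately have "n \<le> length (bispecial (j + 2))"
    using n(2) length_bispecial[of "j + 2", unfolded e] by linarith
  then have c: "length ?c = n" "right_special ?c" using sfx right_special_bispecial[OF j2] right_special_suffix by blast+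
  have cs: "suffix ((\<not> E_index (j + 2)) # dprefix (j + 2)) ?c" by (rule sfx_suffix[OF bispecial_suffix[OF j2]]) (use n2 in simp)
  have "suffix (E_index j # dprefix j) (dprefix (j + 2))" using j by (intro dprefix_suffix_next) auto
  then have cs': "suffix (E_index j # dprefix j) ?c"
    using cs by (meson suffix_ConsD suffix_order.trans)
  have as': "suffix (E_index (j + 2) # dprefix (j + 2)) ?a" using j n2 N by (intro sfx_suffix dprefix_suffix_next) auto
  have "?b \<noteq> ?c" using cs' bs suffix_same by metis
  moreover have "?a \<noteq> ?c" using cs as' suffix_same by metis
  ultimately have "card {?a, ?b, ?c} = 3" using ab by simp
  moreover have "card (dfactors n) + card {?a, ?b, ?c} \<le> card (dfactors (Suc n))"
    by (intro card_dfactors_Suc) (use a b c in auto)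
  ultimately show "card (dfactors n) + 3 \<le> card (dfactors (Suc n))" by simp
qed

section \<open>Growth of the lengths with odd index\<close>

lemma dlen_2_mult: "dlen (4 * k + 10) + dlen (4 * k + 6) = 2 * dlen (4 * k + 9)"
proof -
  have "(4 * k + 10) mod 4 = 2" by presburger
  then show ?thesis using dlen_2[of "4 * k + 10"] by (simp add: add.commute)
qed

lemma dlen_0_mult: "dlen (4 * k + 8) + dlen (4 * k + 4) = 2 * dlen (4 * k + 7)"
proof -
  have "(4 * k + 8) mod 4 = 0" by presburger
  then show ?thesis using dlen_0[of "4 * k + 8"] by (simp add: add.commute)
qed

definition len1 :: "nat \<Rightarrow> nat" where "len1 k = dlen (4 * k + 5)"

definition len3 :: "nat \<Rightarrow> nat" where "len3 k = dlen (4 * k + 7)"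

lemma len1_len3_Suc: "dlen (4 * k + 9) = len1 (Suc k)" "dlen (4 * k + 11) = len3 (Suc k)"
  by (simp_all add: len1_def len3_def add.commute)

lemma len1_Suc: "len1 (Suc k) + len1 k = 4 * len3 k + 6"
  using dlen_1_mult[of "Suc k"] dlen_1_mult[of k] dlen_0_mult[of k] unfolding len1_def len3_def
  by (simp add: add.commute)

lemma len3_Suc: "len3 (Suc k) + len3 k + 4 = 4 * len1 (Suc k)"
  using dlen_3_mult[of "Suc k"] dlen_3_mult[of k] dlen_2_mult[of k] unfolding len1_def len3_def
  by (simp add: add.commute)

lemma len1_len3_0: "len1 0 = 21" "len3 0 = 76"
proof -
  show a: "len1 0 = 21" using dlen_1_mult[of 0] by (simp add: len1_def dlen_small)
  have "dlen 6 + 3 = 42" using dlen_2[of 6] a by (simp add: len1_def dlen_small)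
  then show "len3 0 = 76" using dlen_3_mult[of 0] by (simp add: len3_def)
qed

text \<open>The form \<open>(y - 2 * x)\<^sup>2 - 3 * x\<^sup>2\<close> equals
  \<open>x\<^sup>2 - 4 * x * y + y\<^sup>2\<close>, which does not change from \<open>(x, y)\<close>
  to \<open>(y, 4 * y - x)\<close>; two such steps are taken. Its value 132 is that at the initial
  normalised lengths 62 and 232.\<close>

lemma pell_step:
  fixes x y :: int
  assumes "(y - 2 * x)\<^sup>2 = 3 * x\<^sup>2 + 132"
  shows "(4 * (4 * y - x) - y - 2 * (4 * y - x))\<^sup>2 = 3 * (4 * y - x)\<^sup>2 + 132"
  using assms by algebra

text \<open>The odd-indexed lengths, affinely normalised, satisfy \<open>z'' = 4 z' - z\<close>; the quadratic form
  preserved by this recurrence shows that their ratio exceeds \<open>2 + sqrt 3\<close>.\<close>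

lemma dlen_form:
  defines "X \<equiv> \<lambda>k. 3 * int (len1 k) - 1" and "Y \<equiv> \<lambda>k. 3 * int (len3 k) + 4"
  shows "(Y k - 2 * X k)\<^sup>2 = 3 * (X k)\<^sup>2 + 132" and "2 * X k < Y k" and "0 < X k"
proof -
  have "(Y k - 2 * X k)\<^sup>2 = 3 * (X k)\<^sup>2 + 132 \<and> 2 * X k < Y k \<and> 0 < X k"
  proof (induction k)
    case 0
    show ?case by (simp add: X_def Y_def len1_len3_0)
  next
    case (Suc k)
    have "int (len1 (Suc k)) = 4 * int (len3 k) + 6 - int (len1 k)" using len1_Suc[of k] by linarith
    then have X: "X (Suc k) = 4 * Y k - X k" unfolding X_def Y_def by simp
    have "int (len3 (Suc k)) = 4 * int (len1 (Suc k)) - 4 - int (len3 k)" using len3_Suc[of k] by linarith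
    then have Y: "Y (Suc k) = 4 * X (Suc k) - Y k" unfolding X_def Y_def by simp
    have "(Y (Suc k) - 2 * X (Suc k))\<^sup>2 = 3 * (X (Suc k))\<^sup>2 + 132"
      unfolding Y X by (rule pell_step) (use Suc in blast)
    moreover have "2 * X (Suc k) < Y (Suc k)" "0 < X (Suc k)" using Suc unfolding Y X by simp_all
    ultimately show ?case by blast
  qed
  then show "(Y k - 2 * X k)\<^sup>2 = 3 * (X k)\<^sup>2 + 132" "2 * X k < Y k" "0 < X k" by auto
qed

text \<open>The factor is \<open>2 + sqrt 3\<close> truncated after seven decimals; the constant 3
  absorbs the affine normalisation.\<close>

lemma dlen_ratio: "37320508 / 10000000 * real (len1 k) - 3 \<le> real (len3 k)"
proof -
  define x y where "x = 3 * real (len1 k) - 1" and "y = 3 * real (len3 k) + 4"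
  note f = dlen_form[of k]
  have x: "x = of_int (3 * int (len1 k) - 1)" and y: "y = of_int (3 * int (len3 k) + 4)"
    by (simp_all add: x_def y_def)
  have "(y - 2 * x)\<^sup>2 = of_int ((3 * int (len3 k) + 4 - 2 * (3 * int (len1 k) - 1))\<^sup>2)"
    unfolding x y by simp
  also have "\<dots> = 3 * x\<^sup>2 + 132" unfolding f(1) x by simp
  finally have sq: "(y - 2 * x)\<^sup>2 = 3 * x\<^sup>2 + 132" .
  have pos: "2 * x < y" "0 < x" unfolding x y using f(2,3) by linarith+
  have "(17320508 / 10000000 * x)\<^sup>2 \<le> (y - 2 * x)\<^sup>2"
  proof -
    have "(17320508 / 10000000 :: real)\<^sup>2 \<le> 3" by (simp add: power2_eq_square)
    then have "(17320508 / 10000000)\<^sup>2 * x\<^sup>2 \<le> 3 * x\<^sup>2" by (rule mult_right_mono) simp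
    then show ?thesis unfolding sq power_mult_distrib by linarith
  qed
  then have "17320508 / 10000000 * x \<le> y - 2 * x" 
    by (rule power2_le_imp_le) (use pos in simp)
  then show ?thesis unfolding x_def y_def by simp
qed

section \<open>Summing up the growth of the complexity\<close>

lemma card_dfactors_steps:
  assumes "a \<le> b" "\<And>n. a < n \<Longrightarrow> n \<le> b \<Longrightarrow> card (dfactors n) + d \<le> card (dfactors (Suc n))"
  shows "card (dfactors (Suc a)) + d * b \<le> card (dfactors (Suc b)) + d * a"
  using assms
proof (induction b rule: dec_induct)
  case (step b)
  have "card (dfactors (Suc a)) + d * b \<le> card (dfactors (Suc b)) + d * a" using step by auto
  moreover have "card (dfactors (Suc b)) + d \<le> card (dfactors (Suc (Suc b)))" using step by auto
  ultimately show ?case by simp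
qed simp

lemma card_dfactors_3_steps:
  assumes j: "odd j" "j \<ge> 5"
  shows "card (dfactors (Suc (dlen (j + 2)))) + 3 * length (bispecial j)
    \<le> card (dfactors (Suc (length (bispecial j)))) + 3 * dlen (j + 2)"
proof (rule card_dfactors_steps)
  show "dlen (j + 2) \<le> length (bispecial j)" using length_bispecial[of j] dlen_mono[of "j - 1" j] by simp
  fix n assume n: "dlen (j + 2) < n" "n \<le> length (bispecial j)"
  moreover have "dlen j \<le> dlen (j + 2)" by (rule dlen_mono) simp
  ultimately show "card (dfactors n) + 3 \<le> card (dfactors (Suc n))" using j by (intro card_dfactors_Suc_ge(2)) auto
qed

lemma card_dfactors_2_steps:
  assumes j: "odd j" "j \<ge> 5"
  shows "card (dfactors (Suc (length (bispecial j)))) + 2 * dlen (j + 4)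
    \<le> card (dfactors (Suc (dlen (j + 4)))) + 2 * length (bispecial j)"
proof (rule card_dfactors_steps)
  show "length (bispecial j) \<le> dlen (j + 4)" using j by (intro length_bispecial_le) auto
  fix n assume n: "length (bispecial j) < n" "n \<le> dlen (j + 4)"
  have e: "j + 2 + 2 = j + 4" by simp
  have "dlen (j + 2) \<le> length (bispecial j)" using length_bispecial[of j] dlen_mono[of "j - 1" j] by simp
  \<comment> \<open>Beyond \<open>bispecial j\<close>, the second right special factor is a suffix
    of \<open>bispecial (j + 2)\<close>.\<close>
  moreover have "dlen (j + 4) \<le> length (bispecial (j + 2))"
  proof -
    have "dlen (j + 2 - 1) \<le> dlen (j + 2)" by (rule dlen_mono) simp
    then show ?thesis using length_bispecial[of "j + 2", unfolded e] by linarith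
  qed
  ultimately show "card (dfactors n) + 2 \<le> card (dfactors (Suc n))"
    using n j by (intro card_dfactors_Suc_ge(1)[of "j + 2"]) auto
qed

lemma length_bispecial_1: "length (bispecial (4 * k + 5)) = len3 k + len1 k + 3"
proof -
  have e: "4 * k + 5 - 1 = 4 * k + 4" "4 * k + 5 + 2 = 4 * k + 7" by simp_all
  show ?thesis
    using length_bispecial[of "4 * k + 5", unfolded e] dlen_1_mult[of k] unfolding len1_def len3_def by linarith
qed

lemma length_bispecial_3: "length (bispecial (4 * k + 7)) + 2 = len1 (Suc k) + len3 k"
proof -
  have e: "4 * k + 7 - 1 = 4 * k + 6" "4 * k + 7 + 2 = 4 * k + 9" by simp_all
  show ?thesis
    using length_bispecial[of "4 * k + 7", unfolded e len1_len3_Suc] dlen_3_mult[of k] unfolding len3_def by linarith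
qed

text \<open>Right special factors of length \<open>n\<close> act on the step from \<open>n\<close>
  to \<open>Suc n\<close>, and their ranges start just above some \<open>dlen j\<close>. With the
  shift, sums over these ranges start and end at the lengths themselves.\<close>

definition dcomplexity :: "nat \<Rightarrow> nat" where "dcomplexity n = card (dfactors (Suc n))"

lemma dcomplexity_steps_1:
  "dcomplexity (len3 k) + 3 * len1 k + 9 \<le> dcomplexity (len3 k + len1 k + 3)"
  "dcomplexity (len3 k + len1 k + 3) + 2 * len1 (Suc k) \<le> dcomplexity (len1 (Suc k)) + 2 * len3 k + 2 * len1 k + 6"
proof -
  have e: "4 * k + 5 + 2 = 4 * k + 7" "4 * k + 5 + 4 = 4 * k + 9" by simp_all
  have o: "odd (4 * k + 5)" "4 * k + 5 \<ge> 5" by simp_all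
  have "dcomplexity (len3 k) + 3 * (len3 k + len1 k + 3) \<le> dcomplexity (len3 k + len1 k + 3) + 3 * len3 k"
    using card_dfactors_3_steps[OF o, unfolded e] unfolding length_bispecial_1 dcomplexity_def by (simp only: len3_def)
  then show "dcomplexity (len3 k) + 3 * len1 k + 9 \<le> dcomplexity (len3 k + len1 k + 3)" by simp
  have "dcomplexity (len3 k + len1 k + 3) + 2 * len1 (Suc k) \<le> dcomplexity (len1 (Suc k)) + 2 * (len3 k + len1 k + 3)"
    using card_dfactors_2_steps[OF o, unfolded e] unfolding length_bispecial_1 len1_len3_Suc dcomplexity_def .
  then show "dcomplexity (len3 k + len1 k + 3) + 2 * len1 (Suc k) \<le> dcomplexity (len1 (Suc k)) + 2 * len3 k + 2 * len1 k + 6"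
    by simp
qed

lemma dcomplexity_steps_3:
  "dcomplexity (len1 (Suc k)) + 2 * len3 (Suc k) + len3 k \<le> dcomplexity (len3 (Suc k)) + 2 * len1 (Suc k) + 2"
proof -
  have e: "4 * k + 7 + 2 = 4 * k + 9" "4 * k + 7 + 4 = 4 * k + 11" by simp_all
  have o: "odd (4 * k + 7)" "4 * k + 7 \<ge> 5" by simp_all
  define D where "D = length (bispecial (4 * k + 7))"
  have "dcomplexity (len1 (Suc k)) + 3 * D \<le> dcomplexity D + 3 * len1 (Suc k)"
    using card_dfactors_3_steps[OF o, unfolded e len1_len3_Suc] unfolding D_def dcomplexity_def .
  moreover have "dcomplexity D + 2 * len3 (Suc k) \<le> dcomplexity (len3 (Suc k)) + 2 * D"
    using card_dfactors_2_steps[OF o, unfolded e len1_len3_Suc] unfolding D_def dcomplexity_def .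
  moreover have "D + 2 = len1 (Suc k) + len3 k" unfolding D_def by (rule length_bispecial_3)
  ultimately show ?thesis by linarith
qed

text \<open>By the recurrences, the gains over four indices reproduce the bound exactly. The
  constant \<open>317 = 5 * 76 - 3 * 21\<close> makes it trivial for \<open>k = 0\<close>.\<close>

lemma dcomplexity_lower: "5 * len3 k \<le> 2 * dcomplexity (len3 k) + 3 * len1 k + 317"
proof (induction k)
  case 0
  show ?case by (simp add: len1_len3_0)
next
  case (Suc k)
  then show ?case
    using dcomplexity_steps_1[of k] dcomplexity_steps_3[of k] len1_Suc[of k] len3_Suc[of k] by linarith
qed

text \<open>The length exceeds that of \<open>bispecial (4 * k + 5)\<close> by 2: one for the shift
  in \<open>dcomplexity\<close>, one for passing from \<open>v\<close> to \<open>u_p\<close>. A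
  range with three right special factors ends there.\<close>

lemma complexity_lower: "5 * len3 k + 3 * len1 k \<le> factor_complexity u_p (len3 k + len1 k + 5) + 299"
proof -
  have "Suc (Suc (len3 k + len1 k + 3)) = len3 k + len1 k + 5" by simp
  then have "2 * dcomplexity (len3 k + len1 k + 3) \<le> factor_complexity u_p (len3 k + len1 k + 5)"
    using card_dfactors_complexity[of "Suc (len3 k + len1 k + 3)"] unfolding dcomplexity_def by metis
  then show ?thesis using dcomplexity_lower[of k] dcomplexity_steps_1(1)[of k] by linarith
qed

theorem theorem3:
  shows "limsup (\<lambda>n. ereal (real (factor_complexity u_p n) / real n)) \<ge> ereal 4.57735"
  unfolding limsup_INF_SUP
proof (rule INF_greatest)
  fix m :: nat
  \<comment> \<open>With \<open>b\<close> about \<open>3.7320508 * a\<close>, the final inequality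
    has a margin of only about \<open>1.27e-6 * a\<close> to beat constants adding up to about 323.
    Hence \<open>a\<close> must exceed 255 million or so, which the crude bound
    \<open>k \<le> a\<close> ensures.\<close>
  define k where "k = m + 300000000"
  define a b where "a = len1 k" and "b = len3 k"
  define N where "N = b + a + 5"
  have a: "k \<le> a" using le_dlen[of "4 * k + 5"] by (simp add: a_def len1_def)
  have r: "37320508 / 10000000 * real a - 3 \<le> real b" unfolding a_def b_def by (rule dlen_ratio)
  have "5 * b + 3 * a \<le> factor_complexity u_p N + 299"
    unfolding N_def a_def b_def by (rule complexity_lower)
  then have "real (5 * b + 3 * a) \<le> real (factor_complexity u_p N + 299)" by (rule of_nat_mono)
  then have c: "5 * real b + 3 * real a - 299 \<le> real (factor_complexity u_p N)" by simp
  have "300000000 \<le> real a" using a by (simp add: k_def)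
  moreover have N: "real N = real b + real a + 5" by (simp add: N_def)
  ultimately have "457735 / 100000 * real N \<le> 5 * real b + 3 * real a - 299"
    using r unfolding N distrib_left by linarith
  then have "457735 / 100000 * real N \<le> real (factor_complexity u_p N)" using c by linarith
  moreover have "0 < real N" by (simp add: N_def)
  ultimately have "457735 / 100000 \<le> real (factor_complexity u_p N) / real N"
    by (simp only: pos_le_divide_eq)
  then have "ereal 4.57735 \<le> ereal (real (factor_complexity u_p N) / real N)" by simp
  moreover have "m \<le> N" using a by (simp add: N_def k_def)
  ultimately show "ereal 4.57735 \<le> (SUP n\<in>{m..}. ereal (real (factor_complexity u_p n) / real n))"
    by (intro SUP_upper2[of N "{m..}"] atLeast_iff[THEN iffD2])
qed

end
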